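(* Let $K$ be an irreducible Markov kernel on $\mathcal{X}=\{1,\dots,n\}$ with stationary distribution $\pi$, Dirichlet form $\mathcal{E}$ and log-Sobolev constant $\alpha$. Let $\epsilon\in(0,1)$ and let $P\in\mathbb{R}[x_1,\dots,x_n]$ be a polynomial such that $\mathrm{Ent}_\pi[x^2]\le P(x)\le(1+\epsilon)\mathrm{Ent}_\pi[x^2]$ for all $x\in S^\pi$. For $d\ge\frac12\deg P$ let $\gamma_d^*=\inf\{\gamma\in\mathbb{R}:\gamma\,\mathcal{E}(x,x)-P(x)\in\mathsf{SOS}_d(S^\pi)\}$ (with $\gamma_d^*=+\infty$ if the set is empty) and $\alpha_d^P=1/\gamma_d^*$ (with $1/(+\infty)=0$). Then $\alpha_d^P\le\alpha$ for all such $d$, and there exists $d_0\in\mathbb{N}$ such that $\alpha_d^P\ge(1-\epsilon)\alpha$ for every $d\ge d_0$.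
   Context: A Markov kernel $K$ on $\mathcal{X}$ is a matrix with $K_{ij}\ge0$, $\sum_j K_{ij}=1$; irreducibility gives a unique stationary distribution $\pi$ with all $\pi_i>0$. Dirichlet form: $\mathcal{E}(x,x)=\frac12\sum_{i,j}\pi_iK_{ij}(x_i-x_j)^2$. Write $\|x\|_\pi^2=\sum_i\pi_ix_i^2$ and $\mathrm{Ent}_\pi[x^2]=\sum_i\pi_ix_i^2\log(x_i^2/\|x\|_\pi^2)$. The log-Sobolev constant $\alpha$ is the largest constant with $\mathcal{E}(x,x)\ge\alpha\,\mathrm{Ent}_\pi[x^2]$ for all $x\in\mathbb{R}^n$. $S^\pi=\{x\in\mathbb{R}^n_{\ge0}:\|x\|_\pi^2=1\}$. $\Sigma[x]_{2k}$ denotes sums of squares of polynomials of degree $\le k$. Define $\mathsf{SOS}_d(S^\pi)=\{f\in\mathbb{R}[x]_{2d}: f=\sigma_0+\sum_{i=1}^n x_i\sigma_i+\phi\,(\|x\|_\pi^2-1),\ \sigma_0\in\Sigma[x]_{2d},\ \sigma_i\in\Sigma[x]_{2d-2},\ \phi\in\mathbb{R}[x]_{2d-2}\}$. *)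

theory Defs
  imports Complex_Main
begin

text \<open>State space X = {0..<n} (the paper's {1..n}, shifted). Vectors x in R^n are
  functions nat => real, only the coordinates x i with i < n matter.
  Polynomials in n variables over R are represented by the polynomial functions they
  induce on R^n (faithful since R is infinite).\<close>

definition monomials_le :: "nat \<Rightarrow> nat \<Rightarrow> (nat \<Rightarrow> nat) set" where
  "monomials_le n k = {a. (\<forall>i. n \<le> i \<longrightarrow> a i = 0) \<and> (\<Sum>i<n. a i) \<le> k}"

definition monom_eval :: "nat \<Rightarrow> (nat \<Rightarrow> nat) \<Rightarrow> (nat \<Rightarrow> real) \<Rightarrow> real" where
  "monom_eval n a x = (\<Prod>i<n. x i ^ a i)"

definition poly_deg_le :: "nat \<Rightarrow> nat \<Rightarrow> ((nat \<Rightarrow> real) \<Rightarrow> real) \<Rightarrow> bool" where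
  "poly_deg_le n k f \<longleftrightarrow>
     (\<exists>c. f = (\<lambda>x. \<Sum>a\<in>monomials_le n k. c a * monom_eval n a x))"

definition is_poly :: "nat \<Rightarrow> ((nat \<Rightarrow> real) \<Rightarrow> real) \<Rightarrow> bool" where
  "is_poly n f \<longleftrightarrow> (\<exists>k. poly_deg_le n k f)"

definition poly_degree :: "nat \<Rightarrow> ((nat \<Rightarrow> real) \<Rightarrow> real) \<Rightarrow> nat" where
  "poly_degree n f = (LEAST k. poly_deg_le n k f)"

definition sos :: "nat \<Rightarrow> nat \<Rightarrow> ((nat \<Rightarrow> real) \<Rightarrow> real) \<Rightarrow> bool" where
  "sos n k f \<longleftrightarrow>
     (\<exists>gs. (\<forall>g\<in>set gs. poly_deg_le n k g) \<and> f = (\<lambda>x. \<Sum>g\<leftarrow>gs. (g x)\<^sup>2))"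

definition norm_pi_sq :: "nat \<Rightarrow> (nat \<Rightarrow> real) \<Rightarrow> (nat \<Rightarrow> real) \<Rightarrow> real" where
  "norm_pi_sq n \<pi> x = (\<Sum>i<n. \<pi> i * (x i)\<^sup>2)"

text \<open>SOS_d(S^pi). For d = 0 the multipliers sigma_i in Sigma[x]_{-2} and phi in R[x]_{-2}
  are necessarily zero.\<close>
definition SOS_S :: "nat \<Rightarrow> (nat \<Rightarrow> real) \<Rightarrow> nat \<Rightarrow> ((nat \<Rightarrow> real) \<Rightarrow> real) set" where
  "SOS_S n \<pi> d = {f. poly_deg_le n (2*d) f \<and>
     (\<exists>\<sigma>0 \<sigma> \<phi>. sos n d \<sigma>0 \<and>
        (\<forall>i<n. sos n (d - 1) (\<sigma> i)) \<and> poly_deg_le n (2*d - 2) \<phi> \<and>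
        (d = 0 \<longrightarrow> (\<forall>i<n. \<sigma> i = (\<lambda>x. 0)) \<and> \<phi> = (\<lambda>x. 0)) \<and>
        f = (\<lambda>x. \<sigma>0 x + (\<Sum>i<n. x i * \<sigma> i x) + \<phi> x * (norm_pi_sq n \<pi> x - 1)))}"

definition S_pi :: "nat \<Rightarrow> (nat \<Rightarrow> real) \<Rightarrow> (nat \<Rightarrow> real) set" where
  "S_pi n \<pi> = {x. (\<forall>i<n. 0 \<le> x i) \<and> norm_pi_sq n \<pi> x = 1}"

definition markov_kernel :: "nat \<Rightarrow> (nat \<Rightarrow> nat \<Rightarrow> real) \<Rightarrow> bool" where
  "markov_kernel n K \<longleftrightarrow> (\<forall>i<n. (\<forall>j<n. 0 \<le> K i j) \<and> (\<Sum>j<n. K i j) = 1)"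

fun kpow :: "nat \<Rightarrow> (nat \<Rightarrow> nat \<Rightarrow> real) \<Rightarrow> nat \<Rightarrow> nat \<Rightarrow> nat \<Rightarrow> real" where
  "kpow n K 0 i j = (if i = j then 1 else 0)"
| "kpow n K (Suc m) i j = (\<Sum>l<n. kpow n K m i l * K l j)"

definition irreducible_kernel :: "nat \<Rightarrow> (nat \<Rightarrow> nat \<Rightarrow> real) \<Rightarrow> bool" where
  "irreducible_kernel n K \<longleftrightarrow> (\<forall>i<n. \<forall>j<n. \<exists>m. 0 < kpow n K m i j)"

definition stationary :: "nat \<Rightarrow> (nat \<Rightarrow> nat \<Rightarrow> real) \<Rightarrow> (nat \<Rightarrow> real) \<Rightarrow> bool" where
  "stationary n K \<pi> \<longleftrightarrow> (\<forall>i<n. 0 \<le> \<pi> i) \<and> (\<Sum>i<n. \<pi> i) = 1 \<and>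
     (\<forall>j<n. (\<Sum>i<n. \<pi> i * K i j) = \<pi> j)"

definition dirichlet :: "nat \<Rightarrow> (nat \<Rightarrow> nat \<Rightarrow> real) \<Rightarrow> (nat \<Rightarrow> real) \<Rightarrow> (nat \<Rightarrow> real) \<Rightarrow> real" where
  "dirichlet n K \<pi> x = (1/2) * (\<Sum>i<n. \<Sum>j<n. \<pi> i * K i j * (x i - x j)\<^sup>2)"

definition ent :: "nat \<Rightarrow> (nat \<Rightarrow> real) \<Rightarrow> (nat \<Rightarrow> real) \<Rightarrow> real" where
  "ent n \<pi> x = (\<Sum>i<n. if x i = 0 then 0
       else \<pi> i * (x i)\<^sup>2 * ln ((x i)\<^sup>2 / norm_pi_sq n \<pi> x))"

definition log_sobolev :: "nat \<Rightarrow> (nat \<Rightarrow> nat \<Rightarrow> real) \<Rightarrow> (nat \<Rightarrow> real) \<Rightarrow> real" where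
  "log_sobolev n K \<pi> = Sup {a. \<forall>x. a * ent n \<pi> x \<le> dirichlet n K \<pi> x}"

definition gamma_set :: "nat \<Rightarrow> (nat \<Rightarrow> nat \<Rightarrow> real) \<Rightarrow> (nat \<Rightarrow> real) \<Rightarrow>
    ((nat \<Rightarrow> real) \<Rightarrow> real) \<Rightarrow> nat \<Rightarrow> real set" where
  "gamma_set n K \<pi> P d = {\<gamma>. (\<lambda>x. \<gamma> * dirichlet n K \<pi> x - P x) \<in> SOS_S n \<pi> d}"

text \<open>alpha_d^P = 1 / gamma_d^*, with gamma_d^* = +infinity (so alpha_d^P = 0) if the set is empty\<close>
definition alpha_P :: "nat \<Rightarrow> (nat \<Rightarrow> nat \<Rightarrow> real) \<Rightarrow> (nat \<Rightarrow> real) \<Rightarrow>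
    ((nat \<Rightarrow> real) \<Rightarrow> real) \<Rightarrow> nat \<Rightarrow> real" where
  "alpha_P n K \<pi> P d =
     (if gamma_set n K \<pi> P d = {} then 0 else 1 / Inf (gamma_set n K \<pi> P d))"

end

theory Submission
  imports Defs "HOL-Analysis.Analysis"
begin

text \<open>
  Every \<open>\<gamma>\<close> admitted at some level satisfies \<open>\<gamma> \<E> \<ge> P \<ge> Ent\<close> on \<open>S\<^sup>\<pi>\<close>, hence \<open>\<gamma> \<E> \<ge> Ent\<close> everywhere by
  homogeneity and \<open>\<E>(|x|) \<le> \<E>(x)\<close>; this gives the upper bound. For the lower bound take
  \<open>\<gamma> = 1 / ((1 - \<epsilon>) \<alpha>)\<close>. Since \<open>1 / (1 - \<epsilon>) > 1 + \<epsilon>\<close>, the polynomial \<open>f = \<gamma> \<E> - P\<close> dominates a positive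
  multiple of \<open>\<E>\<close> on \<open>S\<^sup>\<pi>\<close>, hence, by the Poincare inequality, a positive multiple of \<open>\<parallel>x - e\<parallel>\<^sup>2\<close> with
  \<open>e = (1, \<dots>, 1)\<close>. Such an \<open>f\<close> has a certificate. With \<open>y = x - e\<close> and \<open>s = \<parallel>x\<parallel>\<^sup>2 - 1\<close>, Taylor expansion gives
  \<open>f(x) \<equiv> G\<^sub>x(y)\<close> modulo \<open>s\<close> for quadratic forms \<open>G\<^sub>x\<close> depending polynomially on \<open>x\<close>, where \<open>G\<^sub>e\<close> is positive
  definite on the tangent space at \<open>e\<close>. Adding to \<open>G\<^sub>x(v)\<close> suitable multiples of \<open>\<langle>x + e, v\<rangle>\<^sup>2\<close> (which is \<open>s\<^sup>2\<close> at
  \<open>v = y\<close>), of the Gram determinant of \<open>y\<close> and \<open>v\<close> (which vanishes at \<open>v = y\<close>), of \<open>s\<^sup>2 \<parallel>v\<parallel>\<^sup>2\<close> and of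
  \<open>- x\<^sub>i h(x\<^sub>i)\<^sup>2 \<parallel>v\<parallel>\<^sup>2\<close> makes the form positive definite for all \<open>x\<close> in a cube \<open>[-r, r]\<^sup>n\<close>. For a large degree
  its Bernstein coefficients on the cube are then positive definite matrices, while \<open>r \<plusminus> x\<^sub>i\<close>, and so each
  Bernstein basis polynomial, is a sum of squares modulo \<open>s\<close>.
\<close>

section \<open>Polynomial functions\<close>

lemma finite_monomials_le: "finite (monomials_le n k)"
proof (rule finite_subset)
  show "monomials_le n k
      \<subseteq> {a. \<forall>i. (i \<in> {..<n} \<longrightarrow> a i \<in> {..k}) \<and> (i \<notin> {..<n} \<longrightarrow> a i = 0)}"
  proof
    fix a assume a_mem: "a \<in> monomials_le n k"
    have "a i \<le> k" if "i < n" for i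
    proof -
      have "a i \<le> (\<Sum>i<n. a i)" using that by (intro member_le_sum) auto
      then show ?thesis using a_mem by (simp add: monomials_le_def)
    qed
    then show "a \<in> {a. \<forall>i. (i \<in> {..<n} \<longrightarrow> a i \<in> {..k}) \<and> (i \<notin> {..<n} \<longrightarrow> a i = 0)}"
      using a_mem by (auto simp: monomials_le_def)
  qed
  show "finite {a. \<forall>i. (i \<in> {..<n} \<longrightarrow> a i \<in> {..k}) \<and> (i \<notin> {..<n} \<longrightarrow> a i = (0::nat))}"
    by (rule finite_set_of_finite_funs) auto
qed

lemma poly_deg_le_monom:
  assumes "a \<in> monomials_le n k"
  shows "poly_deg_le n k (\<lambda>x. c * monom_eval n a x)"
  unfolding poly_deg_le_def
proof (intro exI[of _ "\<lambda>b. if b = a then c else 0"] ext)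
  fix x
  have "(\<Sum>b\<in>monomials_le n k. (if b = a then c else 0) * monom_eval n b x)
      = (\<Sum>b\<in>monomials_le n k. if b = a then c * monom_eval n a x else 0)"
    by (intro sum.cong) auto
  then show "c * monom_eval n a x
      = (\<Sum>b\<in>monomials_le n k. (if b = a then c else 0) * monom_eval n b x)"
    using assms finite_monomials_le by simp
qed

lemma poly_deg_le_add:
  assumes "poly_deg_le n k f" "poly_deg_le n k g"
  shows "poly_deg_le n k (\<lambda>x. f x + g x)"
proof -
  from assms obtain c d where "f = (\<lambda>x. \<Sum>a\<in>monomials_le n k. c a * monom_eval n a x)"
    "g = (\<lambda>x. \<Sum>a\<in>monomials_le n k. d a * monom_eval n a x)"
    by (auto simp: poly_deg_le_def)
  then show ?thesis unfolding poly_deg_le_def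
    by (intro exI[of _ "\<lambda>a. c a + d a"]) (auto simp: sum.distrib algebra_simps)
qed

lemma poly_deg_le_cmult:
  assumes "poly_deg_le n k f"
  shows "poly_deg_le n k (\<lambda>x. c * f x)"
proof -
  from assms obtain d where "f = (\<lambda>x. \<Sum>a\<in>monomials_le n k. d a * monom_eval n a x)"
    by (auto simp: poly_deg_le_def)
  then show ?thesis unfolding poly_deg_le_def
    by (intro exI[of _ "\<lambda>a. c * d a"]) (auto simp: sum_distrib_left algebra_simps)
qed

lemma poly_deg_le_diff:
  "poly_deg_le n k f \<Longrightarrow> poly_deg_le n k g \<Longrightarrow> poly_deg_le n k (\<lambda>x. f x - g x)"
  using poly_deg_le_add[OF _ poly_deg_le_cmult[of n k g "-1"]] by simp

lemma poly_deg_le_const: "poly_deg_le n k (\<lambda>x. c)"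
proof -
  have "(\<lambda>i. 0) \<in> monomials_le n k" by (simp add: monomials_le_def)
  from poly_deg_le_monom[OF this, of c] show ?thesis by (simp add: monom_eval_def)
qed

lemma poly_deg_le_sum:
  "(\<And>i. i \<in> I \<Longrightarrow> poly_deg_le n k (f i)) \<Longrightarrow> poly_deg_le n k (\<lambda>x. \<Sum>i\<in>I. f i x)"
  by (induction I rule: infinite_finite_induct) (auto intro: poly_deg_le_const poly_deg_le_add)

lemma poly_deg_le_mono:
  assumes "poly_deg_le n k f" "k \<le> l"
  shows "poly_deg_le n l f"
proof -
  from assms obtain d where f_eq: "f = (\<lambda>x. \<Sum>a\<in>monomials_le n k. d a * monom_eval n a x)"
    by (auto simp: poly_deg_le_def)
  have "monomials_le n k \<subseteq> monomials_le n l" using assms(2) by (auto simp: monomials_le_def)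
  then show ?thesis unfolding f_eq by (intro poly_deg_le_sum poly_deg_le_monom) auto
qed

lemma monom_eval_add: "monom_eval n (\<lambda>i. a i + b i) x = monom_eval n a x * monom_eval n b x"
  by (simp add: monom_eval_def power_add prod.distrib)

lemma poly_deg_le_mult:
  assumes "poly_deg_le n k f" "poly_deg_le n l g"
  shows "poly_deg_le n (k + l) (\<lambda>x. f x * g x)"
proof -
  from assms obtain c d where f_eq: "f = (\<lambda>x. \<Sum>a\<in>monomials_le n k. c a * monom_eval n a x)"
    and g_eq: "g = (\<lambda>x. \<Sum>a\<in>monomials_le n l. d a * monom_eval n a x)"
    by (auto simp: poly_deg_le_def)
  have product: "(\<lambda>x. f x * g x) = (\<lambda>x. \<Sum>a\<in>monomials_le n k. \<Sum>b\<in>monomials_le n l.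
      (c a * d b) * monom_eval n (\<lambda>i. a i + b i) x)"
    unfolding f_eq g_eq by (auto simp: sum_product monom_eval_add algebra_simps)
  have "(\<lambda>i. a i + b i) \<in> monomials_le n (k + l)"
    if "a \<in> monomials_le n k" "b \<in> monomials_le n l" for a b
    using that by (auto simp: monomials_le_def sum.distrib)
  then show ?thesis unfolding product by (intro poly_deg_le_sum poly_deg_le_monom) auto
qed

lemma poly_deg_le_coord:
  assumes "i < n"
  shows "poly_deg_le n 1 (\<lambda>x. x i)"
proof -
  have "monom_eval n (\<lambda>j. if j = i then 1 else 0) x = (\<Prod>j<n. if j = i then x j else 1)" for x
    unfolding monom_eval_def by (intro prod.cong) auto
  then have "monom_eval n (\<lambda>j. if j = i then 1 else 0) x = x i" for x
    using assms by simp
  moreover have "(\<lambda>j. if j = i then 1 else 0) \<in> monomials_le n 1"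
    using assms by (auto simp: monomials_le_def)
  from poly_deg_le_monom[OF this, of 1]
  have "poly_deg_le n 1 (\<lambda>x. monom_eval n (\<lambda>j. if j = i then 1 else 0) x)" by simp
  ultimately show ?thesis by simp
qed

lemma poly_deg_le_degree:
  assumes "is_poly n f" "poly_degree n f \<le> k"
  shows "poly_deg_le n k f"
  using assms LeastI_ex[of "\<lambda>k. poly_deg_le n k f"]
  by (auto simp: is_poly_def poly_degree_def intro: poly_deg_le_mono)

lemma is_poly_eventually_deg_le:
  assumes "is_poly n f"
  shows "\<forall>\<^sub>F k in sequentially. poly_deg_le n k f"
  using assms by (auto simp: is_poly_def eventually_sequentially intro: poly_deg_le_mono)

lemma is_poly_const [intro!]: "is_poly n (\<lambda>x. c)"
  unfolding is_poly_def using poly_deg_le_const by blast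

lemma is_poly_coord [intro]: "i < n \<Longrightarrow> is_poly n (\<lambda>x. x i)"
  unfolding is_poly_def using poly_deg_le_coord by blast

lemma is_poly_add [intro!]:
  assumes "is_poly n f" "is_poly n g"
  shows "is_poly n (\<lambda>x. f x + g x)"
  using eventually_happens[OF eventually_conj[OF assms[THEN is_poly_eventually_deg_le]]]
  unfolding is_poly_def by (auto intro: poly_deg_le_add)

lemma is_poly_mult [intro!]:
  "is_poly n f \<Longrightarrow> is_poly n g \<Longrightarrow> is_poly n (\<lambda>x. f x * g x)"
  unfolding is_poly_def by (blast intro: poly_deg_le_mult)

lemma is_poly_uminus [intro!]: "is_poly n f \<Longrightarrow> is_poly n (\<lambda>x. - f x)"
  using is_poly_mult[of n "\<lambda>x. -1" f] by auto

lemma is_poly_diff [intro!]: "is_poly n f \<Longrightarrow> is_poly n g \<Longrightarrow> is_poly n (\<lambda>x. f x - g x)"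
  using is_poly_add[of n f "\<lambda>x. - g x"] by auto

lemma is_poly_divide [intro!]: "is_poly n f \<Longrightarrow> is_poly n (\<lambda>x. f x / c)"
  using is_poly_mult[of n f "\<lambda>x. inverse c"] by (auto simp: divide_inverse)

lemma is_poly_power [intro!]: "is_poly n f \<Longrightarrow> is_poly n (\<lambda>x. f x ^ k)"
  by (induction k) auto

lemma is_poly_sum [intro!]:
  "(\<And>i. i \<in> I \<Longrightarrow> is_poly n (f i)) \<Longrightarrow> is_poly n (\<lambda>x. \<Sum>i\<in>I. f i x)"
  by (induction I rule: infinite_finite_induct) auto

lemma is_poly_monom_eval: "is_poly n (monom_eval n a)"
proof -
  have "is_poly n (\<lambda>x. \<Prod>i\<in>I. x i ^ a i)" if "I \<subseteq> {..<n}" for I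
    using finite_subset[OF that finite_lessThan] that by (induction I rule: finite_induct) auto
  then show ?thesis unfolding monom_eval_def by blast
qed

lemma is_poly_induct_monom [consumes 1, case_names monom add]:
  assumes "is_poly n f"
    and monom: "\<And>c a. Q (\<lambda>x. c * monom_eval n a x)"
    and add: "\<And>f g. is_poly n f \<Longrightarrow> is_poly n g \<Longrightarrow> Q f \<Longrightarrow> Q g \<Longrightarrow> Q (\<lambda>x. f x + g x)"
  shows "Q f"
proof -
  from assms(1) obtain k c where "f = (\<lambda>x. \<Sum>a\<in>monomials_le n k. c a * monom_eval n a x)"
    by (auto simp: is_poly_def poly_deg_le_def)
  moreover have "is_poly n (\<lambda>x. \<Sum>a\<in>M. c a * monom_eval n a x)
      \<and> Q (\<lambda>x. \<Sum>a\<in>M. c a * monom_eval n a x)" for M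
    by (induction M rule: infinite_finite_induct)
      (use monom[of 0] in \<open>auto intro!: monom add is_poly_monom_eval\<close>)
  ultimately show ?thesis by simp
qed

lemma is_poly_induct [consumes 1, case_names const coord add mult]:
  assumes "is_poly n f"
    and const: "\<And>c. Q (\<lambda>x. c)"
    and coord: "\<And>i. i < n \<Longrightarrow> Q (\<lambda>x. x i)"
    and add: "\<And>f g. is_poly n f \<Longrightarrow> is_poly n g \<Longrightarrow> Q f \<Longrightarrow> Q g \<Longrightarrow> Q (\<lambda>x. f x + g x)"
    and mult: "\<And>f g. is_poly n f \<Longrightarrow> is_poly n g \<Longrightarrow> Q f \<Longrightarrow> Q g \<Longrightarrow> Q (\<lambda>x. f x * g x)"
  shows "Q f"
  using assms(1)
proof (induction rule: is_poly_induct_monom)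
  case (monom c a)
  have power: "is_poly n (\<lambda>x. x i ^ k) \<and> Q (\<lambda>x. x i ^ k)" if "i < n" for i k
    using that by (induction k) (auto intro!: const coord mult)
  have "is_poly n (\<lambda>x. \<Prod>i\<in>I. x i ^ a i) \<and> Q (\<lambda>x. \<Prod>i\<in>I. x i ^ a i)" if "I \<subseteq> {..<n}" for I
    using finite_subset[OF that finite_lessThan] that power
    by (induction I rule: finite_induct) (auto intro!: const mult)
  then have "is_poly n (monom_eval n a) \<and> Q (monom_eval n a)"
    unfolding monom_eval_def by blast
  then show ?case by (auto intro!: const mult)
qed (rule add)

lemma is_poly_compose:
  assumes "is_poly n f" "\<And>i. i < n \<Longrightarrow> is_poly m (g i)"
  shows "is_poly m (\<lambda>x. f (\<lambda>i. g i x))"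
  using assms(1) by (induction rule: is_poly_induct) (auto intro: assms(2))

lemma is_poly_cong:
  assumes "is_poly n f" "\<And>i. i < n \<Longrightarrow> x i = y i"
  shows "f x = f y"
  using assms(1) by (induction rule: is_poly_induct) (auto simp: assms(2))

lemma continuous_on_is_poly:
  assumes "is_poly n f" "continuous_on A g"
  shows "continuous_on A (\<lambda>t. f (g t))"
  using assms(1) by (induction rule: is_poly_induct)
    (auto intro!: continuous_intros intro: continuous_on_product_then_coordinatewise[OF assms(2)])

lemma is_poly_Hadamard:
  assumes "is_poly n f"
  shows "\<exists>b. (\<forall>i<n. is_poly n (b i)) \<and> (\<forall>x. f x = f e + (\<Sum>i<n. b i x * (x i - e i)))"
  using assms
proof (induction rule: is_poly_induct)
  case (const c)
  show ?case by (intro exI[of _ "\<lambda>i x. 0"]) auto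
next
  case (coord k)
  have "(\<Sum>i<n. (if i = k then 1 else 0) * (x i - e i)) = (\<Sum>i<n. if i = k then x k - e k else 0)"
    for x by (intro sum.cong) auto
  then show ?case using coord by (intro exI[of _ "\<lambda>i x. if i = k then 1 else 0"]) auto
next
  case (add f g)
  then obtain b c where polys: "\<forall>i<n. is_poly n (b i)" "\<forall>i<n. is_poly n (c i)"
    and f_expansion: "\<And>x. f x = f e + (\<Sum>i<n. b i x * (x i - e i))"
    and g_expansion: "\<And>x. g x = g e + (\<Sum>i<n. c i x * (x i - e i))"
    by blast
  show ?case
  proof (intro exI[of _ "\<lambda>i x. b i x + c i x"] conjI allI impI)
    show "f x + g x = f e + g e + (\<Sum>i<n. (b i x + c i x) * (x i - e i))" for x
      using f_expansion[of x] g_expansion[of x] by (simp add: sum.distrib distrib_right)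
  qed (use polys in auto)
next
  case (mult f g)
  then obtain b c where polys: "\<forall>i<n. is_poly n (b i)" "\<forall>i<n. is_poly n (c i)"
    and f_expansion: "\<And>x. f x = f e + (\<Sum>i<n. b i x * (x i - e i))"
    and g_expansion: "\<And>x. g x = g e + (\<Sum>i<n. c i x * (x i - e i))"
    by blast
  show ?case
  proof (intro exI[of _ "\<lambda>i x. g x * b i x + f e * c i x"] conjI allI impI)
    fix x
    have "f x * g x = f e * g e + g x * (f x - f e) + f e * (g x - g e)"
      by (simp add: algebra_simps)
    also have "f x - f e = (\<Sum>i<n. b i x * (x i - e i))" using f_expansion[of x] by simp
    also have "g x - g e = (\<Sum>i<n. c i x * (x i - e i))" using g_expansion[of x] by simp
    finally show "f x * g x = f e * g e + (\<Sum>i<n. (g x * b i x + f e * c i x) * (x i - e i))"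
      by (simp add: distrib_right sum.distrib sum_distrib_left mult.assoc)
  qed (use polys mult in auto)
qed

section \<open>Quadratic forms\<close>

definition quad_form :: "nat \<Rightarrow> (nat \<Rightarrow> nat \<Rightarrow> real) \<Rightarrow> (nat \<Rightarrow> real) \<Rightarrow> real" where
  "quad_form n A v = (\<Sum>i<n. \<Sum>j<n. A i j * v i * v j)"

definition pos_def :: "nat \<Rightarrow> (nat \<Rightarrow> nat \<Rightarrow> real) \<Rightarrow> bool" where
  "pos_def n A \<longleftrightarrow> (\<forall>v. (\<exists>i<n. v i \<noteq> 0) \<longrightarrow> 0 < quad_form n A v)"

definition schur_complement :: "nat \<Rightarrow> (nat \<Rightarrow> nat \<Rightarrow> real) \<Rightarrow> nat \<Rightarrow> nat \<Rightarrow> real" where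
  "schur_complement n A i j = A i j - (A i n + A n i) / 2 * ((A j n + A n j) / 2) / A n n"

lemma quad_form_cong: "(\<And>i. i < n \<Longrightarrow> v i = w i) \<Longrightarrow> quad_form n A v = quad_form n A w"
  by (auto simp: quad_form_def intro!: sum.cong)

lemma quad_form_scale: "quad_form n A (\<lambda>i. t * v i) = t\<^sup>2 * quad_form n A v"
  by (simp add: quad_form_def sum_distrib_left power2_eq_square mult_ac)

lemma quad_form_diff: "quad_form n A v - quad_form n B v = quad_form n (\<lambda>i j. A i j - B i j) v"
  by (simp add: quad_form_def left_diff_distrib sum_subtractf)

lemma quad_form_weighted_sum:
  "quad_form n (\<lambda>i j. \<Sum>K\<in>S. w K * C K i j) v = (\<Sum>K\<in>S. w K * quad_form n (C K) v)"
proof -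
  have "quad_form n (\<lambda>i j. \<Sum>K\<in>S. w K * C K i j) v
      = (\<Sum>i<n. \<Sum>j<n. \<Sum>K\<in>S. w K * (C K i j * v i * v j))"
    unfolding quad_form_def sum_distrib_right by (simp add: mult.assoc)
  also have "\<dots> = (\<Sum>i<n. \<Sum>K\<in>S. \<Sum>j<n. w K * (C K i j * v i * v j))"
    by (intro sum.cong refl sum.swap)
  also have "\<dots> = (\<Sum>K\<in>S. \<Sum>i<n. \<Sum>j<n. w K * (C K i j * v i * v j))"
    by (rule sum.swap)
  finally show ?thesis by (simp add: quad_form_def sum_distrib_left)
qed

lemma quad_form_complete_square:
  assumes "A n n \<noteq> 0"
  shows "quad_form (Suc n) A v = A n n * (v n + (\<Sum>i<n. (A i n + A n i) / 2 * v i) / A n n)\<^sup>2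
    + quad_form n (schur_complement n A) v"
proof -
  define b where "b = (\<lambda>i. (A i n + A n i) / 2)"
  define l where "l = (\<Sum>i<n. b i * v i)"
  have "l\<^sup>2 / A n n = (\<Sum>i<n. \<Sum>j<n. b i * b j / A n n * v i * v j)"
    unfolding l_def power2_eq_square sum_product sum_divide_distrib
    by (intro sum.cong refl) (simp add: field_simps)
  then have schur: "quad_form n (schur_complement n A) v = quad_form n A v - l\<^sup>2 / A n n"
    unfolding quad_form_def schur_complement_def
    by (simp add: left_diff_distrib sum_subtractf b_def)
  have cross: "(\<Sum>i<n. A i n * v i * v n) + (\<Sum>j<n. A n j * v n * v j) = 2 * v n * l"
    unfolding l_def b_def sum_distrib_left sum.distrib[symmetric]
    by (intro sum.cong refl) (simp add: field_simps)
  have "quad_form (Suc n) A v = quad_form n A v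
      + ((\<Sum>i<n. A i n * v i * v n) + (\<Sum>j<n. A n j * v n * v j)) + A n n * (v n)\<^sup>2"
    by (simp add: quad_form_def sum.distrib power2_eq_square algebra_simps)
  also have "\<dots> = A n n * (v n + l / A n n)\<^sup>2 + quad_form n (schur_complement n A) v"
    unfolding schur cross using assms by (simp add: power2_eq_square field_simps)
  finally show ?thesis by (simp only: l_def b_def)
qed

lemma pos_def_diag: "pos_def (Suc n) A \<Longrightarrow> 0 < A n n"
  unfolding pos_def_def quad_form_def
  by (elim allE[of _ "\<lambda>i. if i = n then 1 else 0"]) simp

lemma pos_def_schur_complement:
  assumes "pos_def (Suc n) A"
  shows "pos_def n (schur_complement n A)"
  unfolding pos_def_def
proof (intro allI impI)
  fix v :: "nat \<Rightarrow> real" assume v_nonzero: "\<exists>i<n. v i \<noteq> 0"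
  define w where "w = v(n := - (\<Sum>i<n. (A i n + A n i) / 2 * v i) / A n n)"
  have "\<exists>i<Suc n. w i \<noteq> 0" using v_nonzero by (auto simp: w_def)
  then have "0 < quad_form (Suc n) A w" using assms by (simp add: pos_def_def)
  also have "\<dots> = quad_form n (schur_complement n A) w"
    using pos_def_diag[OF assms] by (simp add: quad_form_complete_square w_def)
  also have "\<dots> = quad_form n (schur_complement n A) v"
    by (intro quad_form_cong) (simp add: w_def)
  finally show "0 < quad_form n (schur_complement n A) v" .
qed

lemma pos_def_sum_squares:
  assumes "pos_def n A"
  shows "\<exists>ls. \<forall>v. quad_form n A v = (\<Sum>l\<leftarrow>ls. (\<Sum>i<n. l i * v i)\<^sup>2)"
  using assms
proof (induction n arbitrary: A)
  case 0
  show ?case by (intro exI[of _ "[]"]) (simp add: quad_form_def)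
next
  case (Suc n)
  obtain ls where schur_squares:
    "\<And>v. quad_form n (schur_complement n A) v = (\<Sum>l\<leftarrow>ls. (\<Sum>i<n. l i * v i)\<^sup>2)"
    using Suc.IH[OF pos_def_schur_complement[OF Suc.prems]] by blast
  have diag: "0 < A n n" by (rule pos_def_diag[OF Suc.prems])
  define pivot where
    "pivot = (\<lambda>i. sqrt (A n n) * (if i = n then 1 else (A i n + A n i) / 2 / A n n))"
  have pivot: "(\<Sum>i<Suc n. pivot i * v i)\<^sup>2
      = A n n * (v n + (\<Sum>i<n. (A i n + A n i) / 2 * v i) / A n n)\<^sup>2" for v
  proof -
    have "(\<Sum>i<Suc n. pivot i * v i)
        = sqrt (A n n) * (v n + (\<Sum>i<n. (A i n + A n i) / 2 * v i) / A n n)"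
      by (simp add: pivot_def distrib_left sum_distrib_left sum_divide_distrib mult.assoc)
    then show ?thesis using diag by (simp add: power_mult_distrib)
  qed
  show ?case
  proof (intro exI[of _ "pivot # map (\<lambda>l. l(n := 0)) ls"] allI)
    fix v
    have "(\<Sum>i<Suc n. (l(n := 0)) i * v i) = (\<Sum>i<n. l i * v i)" for l :: "nat \<Rightarrow> real"
      by simp
    then have "(\<Sum>l\<leftarrow>map (\<lambda>l. l(n := 0)) ls. (\<Sum>i<Suc n. l i * v i)\<^sup>2)
        = (\<Sum>l\<leftarrow>ls. (\<Sum>i<n. l i * v i)\<^sup>2)"
      by (simp add: o_def)
    then show "quad_form (Suc n) A v
        = (\<Sum>l\<leftarrow>pivot # map (\<lambda>l. l(n := 0)) ls. (\<Sum>i<Suc n. l i * v i)\<^sup>2)"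
      using quad_form_complete_square[of A n v] diag
      by (simp only: list.map sum_list.Cons pivot schur_squares)
  qed
qed

lemma abs_quad_form_le:
  assumes "\<And>i j. i < n \<Longrightarrow> j < n \<Longrightarrow> \<bar>A i j\<bar> \<le> e"
  shows "\<bar>quad_form n A v\<bar> \<le> e * (\<Sum>i<n. \<bar>v i\<bar>)\<^sup>2"
proof -
  have "\<bar>quad_form n A v\<bar> \<le> (\<Sum>i<n. \<Sum>j<n. e * (\<bar>v i\<bar> * \<bar>v j\<bar>))"
    unfolding quad_form_def
  proof (intro order.trans[OF sum_abs] sum_mono order.trans[OF sum_abs])
    fix i j assume "i \<in> {..<n}" "j \<in> {..<n}"
    then show "\<bar>A i j * v i * v j\<bar> \<le> e * (\<bar>v i\<bar> * \<bar>v j\<bar>)"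
      using mult_right_mono[OF assms, of i j "\<bar>v i\<bar> * \<bar>v j\<bar>"] by (simp add: abs_mult mult.assoc)
  qed
  also have "\<dots> = e * (\<Sum>i<n. \<bar>v i\<bar>)\<^sup>2"
    unfolding power2_eq_square sum_product by (simp add: sum_distrib_left)
  finally show ?thesis .
qed

section \<open>Quadratic forms with polynomial coefficients\<close>

definition poly_qform :: "nat \<Rightarrow> ((nat \<Rightarrow> real) \<Rightarrow> (nat \<Rightarrow> real) \<Rightarrow> real) \<Rightarrow> bool" where
  "poly_qform n G \<longleftrightarrow>
     (\<exists>A. (\<forall>i<n. \<forall>j<n. is_poly n (A i j)) \<and> G = (\<lambda>x. quad_form n (\<lambda>i j. A i j x)))"

lemma poly_qformE:
  assumes "poly_qform n G"
  obtains A where "\<And>i j. i < n \<Longrightarrow> j < n \<Longrightarrow> is_poly n (A i j)"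
    and "\<And>x v. G x v = quad_form n (\<lambda>i j. A i j x) v"
  using assms unfolding poly_qform_def by auto

lemma poly_qformI:
  assumes "\<And>i j. i < n \<Longrightarrow> j < n \<Longrightarrow> is_poly n (A i j)"
    and "\<And>x v. G x v = (\<Sum>i<n. \<Sum>j<n. A i j x * v i * v j)"
  shows "poly_qform n G"
  unfolding poly_qform_def quad_form_def using assms by (intro exI[of _ A] conjI ext) auto

lemma poly_qform_add:
  assumes "poly_qform n G" "poly_qform n H"
  shows "poly_qform n (\<lambda>x v. G x v + H x v)"
proof -
  obtain A B where polys: "\<And>i j. i < n \<Longrightarrow> j < n \<Longrightarrow> is_poly n (A i j)"
      "\<And>i j. i < n \<Longrightarrow> j < n \<Longrightarrow> is_poly n (B i j)"
    and forms: "\<And>x v. G x v = quad_form n (\<lambda>i j. A i j x) v"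
      "\<And>x v. H x v = quad_form n (\<lambda>i j. B i j x) v"
    by (metis assms poly_qformE)
  show ?thesis
    by (rule poly_qformI[where A = "\<lambda>i j x. A i j x + B i j x"])
      (auto intro: polys simp: forms quad_form_def sum.distrib distrib_right)
qed

lemma poly_qform_mult:
  assumes "poly_qform n G" "is_poly n g"
  shows "poly_qform n (\<lambda>x v. g x * G x v)"
proof -
  obtain A where "\<And>i j. i < n \<Longrightarrow> j < n \<Longrightarrow> is_poly n (A i j)"
    "\<And>x v. G x v = quad_form n (\<lambda>i j. A i j x) v"
    by (metis assms(1) poly_qformE)
  with assms(2) show ?thesis
    by (intro poly_qformI[where A = "\<lambda>i j x. g x * A i j x"])
      (auto simp: quad_form_def sum_distrib_left mult.assoc)
qed

lemma poly_qform_linear_square: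
  assumes "\<And>i. i < n \<Longrightarrow> is_poly n (b i)"
  shows "poly_qform n (\<lambda>x v. (\<Sum>i<n. b i x * v i)\<^sup>2)"
  by (rule poly_qformI[where A = "\<lambda>i j x. b i x * b j x"])
    (auto intro: assms simp: power2_eq_square sum_product mult_ac)

lemma poly_qform_compose:
  assumes "poly_qform n G" "\<And>i. i < n \<Longrightarrow> is_poly n (g i)"
  shows "poly_qform n (\<lambda>x. G (\<lambda>i. g i x))"
proof -
  obtain A where "\<And>i j. i < n \<Longrightarrow> j < n \<Longrightarrow> is_poly n (A i j)"
    "\<And>x v. G x v = quad_form n (\<lambda>i j. A i j x) v"
    by (metis assms(1) poly_qformE)
  then show ?thesis
    by (intro poly_qformI[where A = "\<lambda>i j x. A i j (\<lambda>i. g i x)"])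
      (auto intro: is_poly_compose assms(2) simp: quad_form_def)
qed

lemma poly_qform_scale: "poly_qform n G \<Longrightarrow> G x (\<lambda>i. t * v i) = t\<^sup>2 * G x v"
  by (auto simp: poly_qform_def quad_form_scale)

lemma poly_qform_cong:
  assumes "poly_qform n G" "\<And>i. i < n \<Longrightarrow> x i = x' i" "\<And>i. i < n \<Longrightarrow> v i = v' i"
  shows "G x v = G x' v'"
proof -
  obtain A where coeffs: "\<And>i j. i < n \<Longrightarrow> j < n \<Longrightarrow> is_poly n (A i j)"
    "\<And>x v. G x v = quad_form n (\<lambda>i j. A i j x) v"
    by (metis assms(1) poly_qformE)
  have "A i j x = A i j x'" if "i < n" "j < n" for i j
    using coeffs(1)[OF that] assms(2) by (rule is_poly_cong)
  then show ?thesis using assms(3) by (simp add: coeffs(2) quad_form_def)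
qed

lemma continuous_on_poly_qform:
  assumes "poly_qform n G" and cont_x: "continuous_on S x" and cont_v: "continuous_on S v"
  shows "continuous_on S (\<lambda>t. G (x t) (v t))"
proof -
  obtain A where coeffs: "\<And>i j. i < n \<Longrightarrow> j < n \<Longrightarrow> is_poly n (A i j)"
    "\<And>x v. G x v = quad_form n (\<lambda>i j. A i j x) v"
    by (metis assms(1) poly_qformE)
  show ?thesis unfolding coeffs(2) quad_form_def
    by (intro continuous_intros continuous_on_product_then_coordinatewise[OF cont_v]
        continuous_on_is_poly[OF coeffs(1) cont_x]) auto
qed

lemma is_poly_Taylor2:
  assumes "is_poly n f"
  obtains D G where "poly_qform n G"
    and "\<And>x. f x = f e + (\<Sum>i<n. D i * (x i - e i)) + G x (\<lambda>i. x i - e i)"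
proof -
  obtain b where b_poly: "\<forall>i<n. is_poly n (b i)"
    and f_expansion: "\<And>x. f x = f e + (\<Sum>i<n. b i x * (x i - e i))"
    using is_poly_Hadamard[OF assms] by blast
  have "\<forall>i. \<exists>a. i < n \<longrightarrow> (\<forall>j<n. is_poly n (a j)) \<and>
      (\<forall>x. b i x = b i e + (\<Sum>j<n. a j x * (x j - e j)))"
    using b_poly is_poly_Hadamard by blast
  then obtain a where a_poly: "\<And>i j. i < n \<Longrightarrow> j < n \<Longrightarrow> is_poly n (a i j)"
    and b_expansion: "\<And>i x. i < n \<Longrightarrow> b i x = b i e + (\<Sum>j<n. a i j x * (x j - e j))"
    by metis
  show ?thesis
  proof
    show "poly_qform n (\<lambda>x. quad_form n (\<lambda>i j. a i j x))"
      unfolding poly_qform_def using a_poly by blast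
    fix x
    have "(\<Sum>i<n. b i x * (x i - e i))
        = (\<Sum>i<n. (b i e + (\<Sum>j<n. a i j x * (x j - e j))) * (x i - e i))"
      by (intro sum.cong refl arg_cong2[where f = "(*)"] b_expansion) simp
    also have "\<dots> = (\<Sum>i<n. b i e * (x i - e i)) + quad_form n (\<lambda>i j. a i j x) (\<lambda>i. x i - e i)"
      by (simp add: quad_form_def distrib_left sum.distrib sum_distrib_left mult_ac)
    finally show "f x = f e + (\<Sum>i<n. b i e * (x i - e i))
        + quad_form n (\<lambda>i j. a i j x) (\<lambda>i. x i - e i)"
      using f_expansion[of x] by simp
  qed
qed

section \<open>Bernstein expansions\<close>

lemma power_eq_sum_Bernstein:
  assumes "j \<le> m"
  shows "u ^ j = (\<Sum>k\<le>m. (real (k choose j) / real (m choose j)) * Bernstein m k u)"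
proof -
  have "(\<Sum>k\<le>m. (real (k choose j) / real (m choose j)) * Bernstein m k u)
      = (\<Sum>k\<in>{j..m}. (real (k choose j) / real (m choose j)) * Bernstein m k u)"
    by (intro sum.mono_neutral_right) auto
  also have "\<dots> = (\<Sum>l\<le>m - j. (real ((l + j) choose j) / real (m choose j)) * Bernstein m (l + j) u)"
    using assms by (intro sum.reindex_bij_witness[of _ "\<lambda>l. l + j" "\<lambda>k. k - j"]) auto
  also have "\<dots> = (\<Sum>l\<le>m - j. u ^ j * Bernstein (m - j) l u)"
  proof (intro sum.cong refl)
    fix l assume "l \<in> {..m - j}"
    then have l_le: "l + j \<le> m" using assms by auto
    have "real (m choose (l + j)) * real ((l + j) choose j)
        = real (m choose j) * real ((m - j) choose l)"
      using choose_mult[of j "l + j" m] l_le by (metis add_diff_cancel_right' le_add2 of_nat_mult)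
    moreover have "real (m choose j) \<noteq> 0" using assms by simp
    moreover have "m - (l + j) = m - j - l" by simp
    ultimately show "(real ((l + j) choose j) / real (m choose j)) * Bernstein m (l + j) u
        = u ^ j * Bernstein (m - j) l u"
      unfolding Bernstein_def by (simp add: power_add field_simps)
  qed
  also have "\<dots> = u ^ j" by (simp add: sum_distrib_left[symmetric])
  finally show ?thesis ..
qed

lemma binomial_quotient_minus_power_le:
  assumes m_large: "2 * j < m" and k_le: "k \<le> m"
  shows "\<bar>real (k choose j) / real (m choose j) - (real k / real m) ^ j\<bar>
    \<le> real j * real j / real (m - j)"
proof -
  have quotient: "real (k choose j) / real (m choose j)
      = (\<Prod>l<j. (real k - real l) / (real m - real l))"
    by (simp add: binomial_gbinomial gbinomial_prod_rev prod_dividef atLeast0LessThan)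
  have "norm ((\<Prod>l<j. (real k - real l) / (real m - real l)) - (\<Prod>l<j. real k / real m))
      \<le> (\<Sum>l<j. norm ((real k - real l) / (real m - real l) - real k / real m))"
    using m_large k_le by (intro norm_prod_diff) (auto simp: abs_if field_simps)
  also have "\<dots> \<le> (\<Sum>l<j. real j / real (m - j))"
  proof (intro sum_mono)
    fix l assume "l \<in> {..<j}"
    then have l_less: "l < j" by simp
    have "(real k - real l) / (real m - real l) - real k / real m
        = - (real l * ((real m - real k) / real m) / (real m - real l))"
      using m_large l_less by (simp add: field_simps)
    also have "norm \<dots> = real l * ((real m - real k) / real m) / (real m - real l)"
      using m_large l_less k_le by simp
    also have "\<dots> \<le> real j * 1 / real (m - j)"
      using m_large l_less k_le by (intro frac_le mult_mono) (auto simp: field_simps of_nat_diff)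
    finally show "norm ((real k - real l) / (real m - real l) - real k / real m)
        \<le> real j / real (m - j)"
      by simp
  qed
  finally show ?thesis unfolding quotient by simp
qed

lemma eventually_binomial_quotient_near_power:
  assumes "0 < e"
  shows "\<forall>\<^sub>F m in sequentially. \<forall>k\<le>m.
    \<bar>real (k choose j) / real (m choose j) - (real k / real m) ^ j\<bar> \<le> e"
proof -
  have "(\<lambda>m. real j * real j / real (m - j)) \<longlonglongrightarrow> 0"
    by (rule LIMSEQ_offset[of _ j]) (simp add: lim_const_over_n)
  then have "\<forall>\<^sub>F m in sequentially. real j * real j / real (m - j) < e"
    using assms by (rule order_tendstoD)
  with eventually_gt_at_top[of "2 * j"] show ?thesis
    by eventually_elim (meson binomial_quotient_minus_power_le less_imp_le order.trans)
qed

definition multi_index :: "nat \<Rightarrow> nat \<Rightarrow> (nat \<Rightarrow> nat) set" where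
  "multi_index n m = PiE {..<n} (\<lambda>_. {..m})"

definition multi_Bernstein :: "nat \<Rightarrow> nat \<Rightarrow> (nat \<Rightarrow> nat) \<Rightarrow> (nat \<Rightarrow> real) \<Rightarrow> real" where
  "multi_Bernstein n m K u = (\<Prod>i<n. Bernstein m (K i) (u i))"

definition grid_point :: "nat \<Rightarrow> (nat \<Rightarrow> nat) \<Rightarrow> nat \<Rightarrow> real" where
  "grid_point m K i = real (K i) / real m"

definition monom_coeff :: "nat \<Rightarrow> nat \<Rightarrow> (nat \<Rightarrow> nat) \<Rightarrow> (nat \<Rightarrow> nat) \<Rightarrow> real" where
  "monom_coeff n m a K = (\<Prod>i<n. real (K i choose a i) / real (m choose a i))"

definition Bernstein_approx ::
  "nat \<Rightarrow> ((nat \<Rightarrow> real) \<Rightarrow> real) \<Rightarrow> nat \<Rightarrow> real \<Rightarrow> ((nat \<Rightarrow> nat) \<Rightarrow> real) \<Rightarrow> bool"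
  where "Bernstein_approx n f m e c \<longleftrightarrow>
    (\<forall>u. f u = (\<Sum>K\<in>multi_index n m. c K * multi_Bernstein n m K u)) \<and>
    (\<forall>K\<in>multi_index n m. \<bar>c K - f (grid_point m K)\<bar> \<le> e)"

lemma grid_point_unit_cube:
  assumes "K \<in> multi_index n m" "i < n"
  shows "0 \<le> grid_point m K i" "grid_point m K i \<le> 1"
proof -
  have "K i \<le> m" using assms by (auto simp: multi_index_def PiE_iff)
  then show "0 \<le> grid_point m K i" "grid_point m K i \<le> 1"
    by (auto simp: grid_point_def divide_le_eq_1)
qed

lemma monom_eval_eq_sum_multi_Bernstein:
  assumes "\<And>i. i < n \<Longrightarrow> a i \<le> m"
  shows "monom_eval n a u = (\<Sum>K\<in>multi_index n m. monom_coeff n m a K * multi_Bernstein n m K u)"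
proof -
  have "monom_eval n a u
      = (\<Prod>i<n. \<Sum>k\<le>m. (real (k choose a i) / real (m choose a i)) * Bernstein m k (u i))"
    unfolding monom_eval_def using assms by (intro prod.cong refl power_eq_sum_Bernstein) auto
  also have "\<dots> = (\<Sum>K\<in>multi_index n m.
      \<Prod>i<n. (real (K i choose a i) / real (m choose a i)) * Bernstein m (K i) (u i))"
    unfolding multi_index_def by (intro prod_sum_PiE) auto
  finally show ?thesis by (simp only: prod.distrib multi_Bernstein_def monom_coeff_def)
qed

lemma Bernstein_approx_monom:
  assumes "\<And>i. i < n \<Longrightarrow> a i \<le> m" and "real n * e' \<le> e"
    and near: "\<And>i k. i < n \<Longrightarrow> k \<le> m \<Longrightarrow>
      \<bar>real (k choose a i) / real (m choose a i) - (real k / real m) ^ a i\<bar> \<le> e'"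
  shows "Bernstein_approx n (monom_eval n a) m e (monom_coeff n m a)"
  unfolding Bernstein_approx_def
proof (intro conjI allI ballI)
  show "monom_eval n a u
      = (\<Sum>K\<in>multi_index n m. monom_coeff n m a K * multi_Bernstein n m K u)" for u
    using assms(1) by (rule monom_eval_eq_sum_multi_Bernstein)
next
  fix K assume K_mem: "K \<in> multi_index n m"
  have K_le: "K i \<le> m" if "i < n" for i using K_mem that by (auto simp: multi_index_def PiE_iff)
  have "norm (monom_coeff n m a K - monom_eval n a (grid_point m K))
    \<le> (\<Sum>i<n. norm (real (K i choose a i) / real (m choose a i) - grid_point m K i ^ a i))"
    unfolding monom_coeff_def monom_eval_def
  proof (intro norm_prod_diff)
    fix i assume "i \<in> {..<n}"
    then have i_less: "i < n" by simp
    show "norm (real (K i choose a i) / real (m choose a i)) \<le> 1"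
      using assms(1)[OF i_less] binomial_right_mono[OF K_le[OF i_less], of "a i"]
      by (simp add: field_simps)
    show "norm (grid_point m K i ^ a i) \<le> 1"
      using grid_point_unit_cube[OF K_mem i_less] by (simp add: norm_power power_le_one)
  qed
  also have "\<dots> \<le> (\<Sum>i<n. e')"
    using near K_le by (intro sum_mono) (auto simp: grid_point_def)
  also have "\<dots> \<le> e" using assms(2) by simp
  finally show "\<bar>monom_coeff n m a K - monom_eval n a (grid_point m K)\<bar> \<le> e" by simp
qed

lemma Bernstein_approx_add:
  assumes "Bernstein_approx n f m e c" "Bernstein_approx n g m e' d"
  shows "Bernstein_approx n (\<lambda>u. f u + g u) m (e + e') (\<lambda>K. c K + d K)"
  unfolding Bernstein_approx_def
proof (intro conjI allI ballI)
  show "f u + g u = (\<Sum>K\<in>multi_index n m. (c K + d K) * multi_Bernstein n m K u)" for u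
    using assms by (simp add: Bernstein_approx_def distrib_right sum.distrib)
  fix K assume "K \<in> multi_index n m"
  then have "\<bar>c K - f (grid_point m K)\<bar> \<le> e" "\<bar>d K - g (grid_point m K)\<bar> \<le> e'"
    using assms by (auto simp: Bernstein_approx_def)
  then show "\<bar>c K + d K - (f (grid_point m K) + g (grid_point m K))\<bar> \<le> e + e'" by linarith
qed

lemma Bernstein_approx_cmult:
  assumes "Bernstein_approx n f m e c"
  shows "Bernstein_approx n (\<lambda>u. r * f u) m (\<bar>r\<bar> * e) (\<lambda>K. r * c K)"
  unfolding Bernstein_approx_def
proof (intro conjI allI ballI)
  show "r * f u = (\<Sum>K\<in>multi_index n m. r * c K * multi_Bernstein n m K u)" for u
    using assms by (simp add: Bernstein_approx_def sum_distrib_left mult.assoc)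
  fix K assume "K \<in> multi_index n m"
  then have "\<bar>r\<bar> * \<bar>c K - f (grid_point m K)\<bar> \<le> \<bar>r\<bar> * e"
    using assms by (intro mult_left_mono) (auto simp: Bernstein_approx_def)
  then show "\<bar>r * c K - r * f (grid_point m K)\<bar> \<le> \<bar>r\<bar> * e"
    by (simp add: abs_mult flip: right_diff_distrib)
qed

lemma Bernstein_approx_mono: "Bernstein_approx n f m e c \<Longrightarrow> e \<le> e' \<Longrightarrow> Bernstein_approx n f m e' c"
  by (force simp: Bernstein_approx_def)

theorem eventually_Bernstein_approx:
  assumes "is_poly n f" "0 < e"
  shows "\<forall>\<^sub>F m in sequentially. \<exists>c. Bernstein_approx n f m e c"
  using assms
proof (induction arbitrary: e rule: is_poly_induct_monom)
  case (monom r a)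
  define e' where "e' = e / ((real n + 1) * (\<bar>r\<bar> + 1))"
  have e'_pos: "0 < e'" using monom by (simp add: e'_def add_nonneg_pos)
  have "real n * e' * \<bar>r\<bar> \<le> (real n + 1) * e' * (\<bar>r\<bar> + 1)"
    using e'_pos by (intro mult_mono) auto
  also have "\<dots> = e" by (simp add: e'_def)
  finally have e'_le: "\<bar>r\<bar> * (real n * e') \<le> e" by (simp add: mult_ac)
  have "\<forall>\<^sub>F m in sequentially. \<forall>i\<in>{..<n}. a i \<le> m \<and> (\<forall>k\<le>m.
      \<bar>real (k choose a i) / real (m choose a i) - (real k / real m) ^ a i\<bar> \<le> e')"
    using e'_pos by (intro eventually_ball_finite ballI eventually_conj eventually_ge_at_top
        eventually_binomial_quotient_near_power) auto
  then show ?case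
  proof eventually_elim
    case (elim m)
    then have "Bernstein_approx n (monom_eval n a) m (real n * e') (monom_coeff n m a)"
      by (intro Bernstein_approx_monom[where e' = e']) auto
    then show ?case
      using e'_le Bernstein_approx_mono Bernstein_approx_cmult by blast
  qed
next
  case (add f g)
  have half: "0 < e / 2" using add.prems by simp
  from add.IH(1)[OF half] add.IH(2)[OF half] show ?case
  proof eventually_elim
    case (elim m)
    then obtain c d where "Bernstein_approx n f m (e / 2) c" "Bernstein_approx n g m (e / 2) d"
      by blast
    from Bernstein_approx_add[OF this] show ?case by auto
  qed
qed

lemma eventually_poly_qform_Bernstein:
  assumes "poly_qform n G" "0 < e"
  shows "\<forall>\<^sub>F m in sequentially. \<exists>C.
    (\<forall>u v. G u v = (\<Sum>K\<in>multi_index n m. multi_Bernstein n m K u * quad_form n (C K) v)) \<and>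
    (\<forall>K\<in>multi_index n m. \<forall>v.
      \<bar>quad_form n (C K) v - G (grid_point m K) v\<bar> \<le> e * (\<Sum>i<n. \<bar>v i\<bar>)\<^sup>2)"
proof -
  obtain A where A_poly: "\<And>i j. i < n \<Longrightarrow> j < n \<Longrightarrow> is_poly n (A i j)"
    and G_eq: "\<And>x v. G x v = quad_form n (\<lambda>i j. A i j x) v"
    by (metis assms(1) poly_qformE)
  have "\<forall>\<^sub>F m in sequentially. \<forall>i\<in>{..<n}. \<forall>j\<in>{..<n}. \<exists>c. Bernstein_approx n (A i j) m e c"
    using A_poly assms(2) by (intro eventually_ball_finite ballI eventually_Bernstein_approx) auto
  then show ?thesis
  proof eventually_elim
    case (elim m)
    then obtain c where c_approx: "\<And>i j. i < n \<Longrightarrow> j < n \<Longrightarrow> Bernstein_approx n (A i j) m e (c i j)"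
      by (metis lessThan_iff)
    show ?case
    proof (intro exI[of _ "\<lambda>K i j. c i j K"] conjI allI ballI)
      fix u v
      have "A i j u = (\<Sum>K\<in>multi_index n m. multi_Bernstein n m K u * c i j K)"
        if "i < n" "j < n" for i j
        using c_approx[OF that] unfolding Bernstein_approx_def by (simp add: mult.commute)
      then have "G u v
          = quad_form n (\<lambda>i j. \<Sum>K\<in>multi_index n m. multi_Bernstein n m K u * c i j K) v"
        unfolding G_eq quad_form_def by simp
      then show "G u v
          = (\<Sum>K\<in>multi_index n m. multi_Bernstein n m K u * quad_form n (\<lambda>i j. c i j K) v)"
        by (simp only: quad_form_weighted_sum)
    next
      fix K v assume "K \<in> multi_index n m"
      then have "\<bar>c i j K - A i j (grid_point m K)\<bar> \<le> e" if "i < n" "j < n" for i j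
        using c_approx[OF that] unfolding Bernstein_approx_def by blast
      then show "\<bar>quad_form n (\<lambda>i j. c i j K) v - G (grid_point m K) v\<bar> \<le> e * (\<Sum>i<n. \<bar>v i\<bar>)\<^sup>2"
        unfolding G_eq quad_form_diff by (rule abs_quad_form_le)
    qed
  qed
qed

section \<open>Sums of squares modulo the sphere\<close>

definition poly_sos :: "nat \<Rightarrow> ((nat \<Rightarrow> real) \<Rightarrow> real) \<Rightarrow> bool" where
  "poly_sos n f \<longleftrightarrow> (\<exists>gs. (\<forall>g\<in>set gs. is_poly n g) \<and> f = (\<lambda>x. \<Sum>g\<leftarrow>gs. (g x)\<^sup>2))"

lemma poly_sos_eventually_sos:
  assumes "poly_sos n f"
  shows "\<forall>\<^sub>F d in sequentially. sos n d f"
proof -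
  from assms obtain gs where gs_squares: "\<forall>g\<in>set gs. is_poly n g" "f = (\<lambda>x. \<Sum>g\<leftarrow>gs. (g x)\<^sup>2)"
    by (auto simp: poly_sos_def)
  have "\<forall>\<^sub>F d in sequentially. \<forall>g\<in>set gs. poly_deg_le n d g"
    using gs_squares(1) by (intro eventually_ball_finite) (auto intro: is_poly_eventually_deg_le)
  then show ?thesis by (rule eventually_mono) (auto simp: sos_def gs_squares(2))
qed

lemma poly_sos_is_poly: "poly_sos n f \<Longrightarrow> is_poly n f"
proof -
  have "is_poly n (\<lambda>x. \<Sum>g\<leftarrow>gs. (g x)\<^sup>2)" if "\<forall>g\<in>set gs. is_poly n g" for gs
    using that by (induction gs) auto
  then show "poly_sos n f \<Longrightarrow> is_poly n f" by (auto simp: poly_sos_def)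
qed

lemma poly_sos_square: "is_poly n g \<Longrightarrow> poly_sos n (\<lambda>x. (g x)\<^sup>2)"
  unfolding poly_sos_def by (intro exI[of _ "[g]"]) auto

lemma poly_sos_const: "0 \<le> c \<Longrightarrow> poly_sos n (\<lambda>x. c)"
  using poly_sos_square[of n "\<lambda>x. sqrt c"] by auto

lemma poly_sos_add:
  assumes "poly_sos n f" "poly_sos n g"
  shows "poly_sos n (\<lambda>x. f x + g x)"
proof -
  from assms obtain fs gs where "\<forall>g\<in>set fs. is_poly n g" "f = (\<lambda>x. \<Sum>g\<leftarrow>fs. (g x)\<^sup>2)"
    "\<forall>g\<in>set gs. is_poly n g" "g = (\<lambda>x. \<Sum>g\<leftarrow>gs. (g x)\<^sup>2)"
    by (auto simp: poly_sos_def)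
  then show ?thesis unfolding poly_sos_def by (intro exI[of _ "fs @ gs"]) auto
qed

lemma poly_sos_sum:
  "(\<And>i. i \<in> I \<Longrightarrow> poly_sos n (f i)) \<Longrightarrow> poly_sos n (\<lambda>x. \<Sum>i\<in>I. f i x)"
  by (induction I rule: infinite_finite_induct) (auto intro: poly_sos_const poly_sos_add)

lemma poly_sos_sum_list:
  "(\<And>l. l \<in> set ls \<Longrightarrow> poly_sos n (f l)) \<Longrightarrow> poly_sos n (\<lambda>x. \<Sum>l\<leftarrow>ls. f l x)"
  by (induction ls) (auto intro: poly_sos_const poly_sos_add)

lemma poly_sos_mult:
  assumes "poly_sos n f" "poly_sos n g"
  shows "poly_sos n (\<lambda>x. f x * g x)"
proof -
  from assms obtain fs gs where fs_squares: "\<forall>g\<in>set fs. is_poly n g" "f = (\<lambda>x. \<Sum>g\<leftarrow>fs. (g x)\<^sup>2)"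
    and gs_squares: "\<forall>g\<in>set gs. is_poly n g" "g = (\<lambda>x. \<Sum>g\<leftarrow>gs. (g x)\<^sup>2)"
    by (auto simp: poly_sos_def)
  have "f x * g x = (\<Sum>u\<leftarrow>fs. \<Sum>w\<leftarrow>gs. (u x * w x)\<^sup>2)" for x
    by (simp add: fs_squares(2) gs_squares(2)
        sum_list_mult_const sum_list_const_mult power_mult_distrib)
  then have "(\<lambda>x. f x * g x) = (\<lambda>x. \<Sum>u\<leftarrow>fs. \<Sum>w\<leftarrow>gs. (u x * w x)\<^sup>2)" by auto
  then show ?thesis using fs_squares gs_squares by (auto intro!: poly_sos_sum_list poly_sos_square)
qed

lemma is_poly_norm_pi_sq [intro]:
  "(\<And>i. i < n \<Longrightarrow> is_poly n (\<lambda>x. y x i)) \<Longrightarrow> is_poly n (\<lambda>x. norm_pi_sq n \<pi> (y x))"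
  unfolding norm_pi_sq_def by auto

definition sos_mod :: "nat \<Rightarrow> (nat \<Rightarrow> real) \<Rightarrow> ((nat \<Rightarrow> real) \<Rightarrow> real) \<Rightarrow> bool" where
  "sos_mod n \<pi> f \<longleftrightarrow> (\<exists>\<sigma> \<phi>. poly_sos n \<sigma> \<and> is_poly n \<phi> \<and>
     f = (\<lambda>x. \<sigma> x + \<phi> x * (norm_pi_sq n \<pi> x - 1)))"

lemma sos_modI:
  "poly_sos n \<sigma> \<Longrightarrow> is_poly n \<phi> \<Longrightarrow> (\<And>x. f x = \<sigma> x + \<phi> x * (norm_pi_sq n \<pi> x - 1)) \<Longrightarrow> sos_mod n \<pi> f"
  unfolding sos_mod_def by blast

lemma sos_modE:
  assumes "sos_mod n \<pi> f"
  obtains \<sigma> \<phi> where "poly_sos n \<sigma>" "is_poly n \<phi>" "f = (\<lambda>x. \<sigma> x + \<phi> x * (norm_pi_sq n \<pi> x - 1))"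
  using assms unfolding sos_mod_def by blast

lemma sos_mod_sos: "poly_sos n f \<Longrightarrow> sos_mod n \<pi> f"
  by (rule sos_modI[of n f "\<lambda>x. 0"]) auto

lemma sos_mod_const: "0 \<le> c \<Longrightarrow> sos_mod n \<pi> (\<lambda>x. c)"
  by (intro sos_mod_sos poly_sos_const)

lemma sos_mod_add:
  assumes "sos_mod n \<pi> f" "sos_mod n \<pi> g"
  shows "sos_mod n \<pi> (\<lambda>x. f x + g x)"
proof -
  from assms obtain \<sigma> \<phi> \<sigma>' \<phi>' where "poly_sos n \<sigma>" "is_poly n \<phi>" "poly_sos n \<sigma>'" "is_poly n \<phi>'"
    "f = (\<lambda>x. \<sigma> x + \<phi> x * (norm_pi_sq n \<pi> x - 1))" "g = (\<lambda>x. \<sigma>' x + \<phi>' x * (norm_pi_sq n \<pi> x - 1))"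
    by (elim sos_modE)
  then show ?thesis
    by (intro sos_modI[of n "\<lambda>x. \<sigma> x + \<sigma>' x" "\<lambda>x. \<phi> x + \<phi>' x"] poly_sos_add)
      (auto simp: algebra_simps)
qed

lemma sos_mod_mult:
  assumes "sos_mod n \<pi> f" "sos_mod n \<pi> g"
  shows "sos_mod n \<pi> (\<lambda>x. f x * g x)"
proof -
  from assms obtain \<sigma> \<phi> \<sigma>' \<phi>' where "poly_sos n \<sigma>" "is_poly n \<phi>" "poly_sos n \<sigma>'" "is_poly n \<phi>'"
    "f = (\<lambda>x. \<sigma> x + \<phi> x * (norm_pi_sq n \<pi> x - 1))" "g = (\<lambda>x. \<sigma>' x + \<phi>' x * (norm_pi_sq n \<pi> x - 1))"
    by (elim sos_modE)
  then show ?thesis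
    by (intro sos_modI[of n "\<lambda>x. \<sigma> x * \<sigma>' x"
        "\<lambda>x. \<sigma> x * \<phi>' x + \<phi> x * \<sigma>' x + \<phi> x * \<phi>' x * (norm_pi_sq n \<pi> x - 1)"] poly_sos_mult)
      (auto intro: poly_sos_is_poly simp: algebra_simps)
qed

lemma sos_mod_sum:
  "(\<And>i. i \<in> I \<Longrightarrow> sos_mod n \<pi> (f i)) \<Longrightarrow> sos_mod n \<pi> (\<lambda>x. \<Sum>i\<in>I. f i x)"
  by (induction I rule: infinite_finite_induct) (auto intro: sos_mod_const sos_mod_add)

lemma sos_mod_prod:
  "(\<And>i. i \<in> I \<Longrightarrow> sos_mod n \<pi> (f i)) \<Longrightarrow> sos_mod n \<pi> (\<lambda>x. \<Prod>i\<in>I. f i x)"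
  by (induction I rule: infinite_finite_induct) (auto intro: sos_mod_const sos_mod_mult)

lemma sos_mod_power: "sos_mod n \<pi> f \<Longrightarrow> sos_mod n \<pi> (\<lambda>x. f x ^ k)"
  by (induction k) (auto intro: sos_mod_const sos_mod_mult)

definition quadratic_module :: "nat \<Rightarrow> (nat \<Rightarrow> real) \<Rightarrow> ((nat \<Rightarrow> real) \<Rightarrow> real) set" where
  "quadratic_module n \<pi> = {f. \<exists>\<sigma>0 \<sigma> \<phi>. poly_sos n \<sigma>0 \<and> (\<forall>i<n. poly_sos n (\<sigma> i)) \<and> is_poly n \<phi> \<and>
     f = (\<lambda>x. \<sigma>0 x + (\<Sum>i<n. x i * \<sigma> i x) + \<phi> x * (norm_pi_sq n \<pi> x - 1))}"

lemma quadratic_moduleI: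
  assumes "sos_mod n \<pi> g" "\<And>i. i < n \<Longrightarrow> poly_sos n (\<sigma> i)" "is_poly n \<phi>"
    and f_eq: "\<And>x. f x = g x + (\<Sum>i<n. x i * \<sigma> i x) + \<phi> x * (norm_pi_sq n \<pi> x - 1)"
  shows "f \<in> quadratic_module n \<pi>"
proof -
  obtain \<sigma>0 \<psi> where g_eq: "poly_sos n \<sigma>0" "is_poly n \<psi>"
      "g = (\<lambda>x. \<sigma>0 x + \<psi> x * (norm_pi_sq n \<pi> x - 1))"
    using assms(1) by (rule sos_modE)
  have "f = (\<lambda>x. \<sigma>0 x + (\<Sum>i<n. x i * \<sigma> i x) + (\<psi> x + \<phi> x) * (norm_pi_sq n \<pi> x - 1))"
    by (rule ext) (simp add: f_eq g_eq(3) algebra_simps)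
  with assms(2,3) g_eq(1,2) show ?thesis unfolding quadratic_module_def by blast
qed

lemma quadratic_module_eventually_SOS_S:
  assumes "f \<in> quadratic_module n \<pi>"
  shows "\<forall>\<^sub>F d in sequentially. poly_deg_le n (2 * d) f \<longrightarrow> f \<in> SOS_S n \<pi> d"
proof -
  obtain \<sigma>0 \<sigma> \<phi> where sos: "poly_sos n \<sigma>0" "\<And>i. i < n \<Longrightarrow> poly_sos n (\<sigma> i)"
    and \<phi>_poly: "is_poly n \<phi>"
    and f_eq: "f = (\<lambda>x. \<sigma>0 x + (\<Sum>i<n. x i * \<sigma> i x) + \<phi> x * (norm_pi_sq n \<pi> x - 1))"
    using assms unfolding quadratic_module_def by blast
  have "\<forall>\<^sub>F d in sequentially. \<forall>i\<in>{..<n}. sos n d (\<sigma> i)"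
    using sos(2) by (intro eventually_ball_finite) (auto intro: poly_sos_eventually_sos)
  then have "\<forall>\<^sub>F d in sequentially. \<forall>i\<in>{..<n}. sos n (d - 1) (\<sigma> i)"
    using filterlim_minus_const_nat_at_top by (rule eventually_compose_filterlim)
  moreover have "\<forall>\<^sub>F d in sequentially. poly_deg_le n (2 * d - 2) \<phi>"
    using is_poly_eventually_deg_le[OF \<phi>_poly]
      filterlim_compose[OF filterlim_minus_const_nat_at_top mult_nat_left_at_top]
    by (rule eventually_compose_filterlim) simp
  ultimately show ?thesis
    using poly_sos_eventually_sos[OF sos(1)] eventually_gt_at_top[of 0]
  proof eventually_elim
    case (elim d)
    then show ?case
      unfolding SOS_S_def mem_Collect_eq
      by (intro impI conjI exI[of _ \<sigma>0] exI[of _ \<sigma>] exI[of _ \<phi>] f_eq) auto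
  qed
qed

lemma SOS_S_nonneg:
  assumes "f \<in> SOS_S n \<pi> d" "x \<in> S_pi n \<pi>"
  shows "0 \<le> f x"
proof -
  have sos_nonneg: "0 \<le> \<sigma> x" if "sos n k \<sigma>" for k \<sigma>
    using that by (auto simp: sos_def intro!: sum_list_nonneg)
  obtain \<sigma>0 \<sigma> \<phi> where "sos n d \<sigma>0" "\<forall>i<n. sos n (d - 1) (\<sigma> i)"
    "f = (\<lambda>x. \<sigma>0 x + (\<Sum>i<n. x i * \<sigma> i x) + \<phi> x * (norm_pi_sq n \<pi> x - 1))"
    using assms(1) unfolding SOS_S_def by (elim CollectE conjE exE) (rule that)
  then show ?thesis using assms(2) sos_nonneg
    by (auto simp: S_pi_def intro!: add_nonneg_nonneg sum_nonneg mult_nonneg_nonneg)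
qed

section \<open>Weighted spheres\<close>

definition inner_pi :: "nat \<Rightarrow> (nat \<Rightarrow> real) \<Rightarrow> (nat \<Rightarrow> real) \<Rightarrow> (nat \<Rightarrow> real) \<Rightarrow> real" where
  "inner_pi n \<pi> u v = (\<Sum>i<n. \<pi> i * (u i * v i))"

definition gram_det :: "nat \<Rightarrow> (nat \<Rightarrow> real) \<Rightarrow> (nat \<Rightarrow> real) \<Rightarrow> (nat \<Rightarrow> real) \<Rightarrow> real" where
  "gram_det n \<pi> u v = norm_pi_sq n \<pi> u * norm_pi_sq n \<pi> v - (inner_pi n \<pi> u v)\<^sup>2"

lemma inner_pi_self: "inner_pi n \<pi> u u = norm_pi_sq n \<pi> u"
  by (simp add: inner_pi_def norm_pi_sq_def power2_eq_square)

lemma inner_pi_commute: "inner_pi n \<pi> u v = inner_pi n \<pi> v u"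
  by (simp add: inner_pi_def mult.commute)

lemma inner_pi_combination:
  "inner_pi n \<pi> u (\<lambda>i. a * v i + b * w i) = a * inner_pi n \<pi> u v + b * inner_pi n \<pi> u w"
  by (simp add: inner_pi_def sum_distrib_left flip: sum.distrib) (simp add: algebra_simps)

lemma norm_pi_sq_combination:
  "norm_pi_sq n \<pi> (\<lambda>i. a * u i + b * v i)
    = a\<^sup>2 * norm_pi_sq n \<pi> u + 2 * a * b * inner_pi n \<pi> u v + b\<^sup>2 * norm_pi_sq n \<pi> v"
  unfolding norm_pi_sq_def inner_pi_def sum_distrib_left sum.distrib[symmetric]
  by (intro sum.cong refl) (simp add: power2_eq_square algebra_simps)

lemma norm_pi_sq_scale: "norm_pi_sq n \<pi> (\<lambda>i. t * v i) = t\<^sup>2 * norm_pi_sq n \<pi> v"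
  by (simp add: norm_pi_sq_def sum_distrib_left power_mult_distrib mult_ac)

lemma norm_pi_sq_cong: "(\<And>i. i < n \<Longrightarrow> u i = v i) \<Longrightarrow> norm_pi_sq n \<pi> u = norm_pi_sq n \<pi> v"
  by (simp add: norm_pi_sq_def)

lemma gram_det_self: "gram_det n \<pi> u u = 0"
  by (simp add: gram_det_def inner_pi_self power2_eq_square)

lemma gram_det_unit:
  assumes "norm_pi_sq n \<pi> v = 1"
  shows "gram_det n \<pi> u v = norm_pi_sq n \<pi> (\<lambda>i. u i - inner_pi n \<pi> u v * v i)"
  using norm_pi_sq_combination[of n \<pi> 1 u "- inner_pi n \<pi> u v" v]
  by (simp add: assms gram_det_def power2_eq_square)

lemma poly_qform_norm_pi_sq: "poly_qform n (\<lambda>x. norm_pi_sq n \<pi>)"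
proof (rule poly_qformI[where A = "\<lambda>i j x. if i = j then \<pi> i else 0"])
  fix v
  have "(\<Sum>j<n. (if i = j then \<pi> i else 0) * v i * v j) = \<pi> i * (v i)\<^sup>2" if "i < n" for i
  proof -
    have "(\<Sum>j<n. (if i = j then \<pi> i else 0) * v i * v j)
        = (\<Sum>j<n. if i = j then \<pi> i * (v i)\<^sup>2 else 0)"
      by (intro sum.cong refl) (simp add: power2_eq_square)
    then show ?thesis using that by simp
  qed
  then show "norm_pi_sq n \<pi> v = (\<Sum>i<n. \<Sum>j<n. (if i = j then \<pi> i else 0) * v i * v j)"
    by (simp add: norm_pi_sq_def)
qed auto

lemma continuous_on_norm_pi_sq:
  "continuous_on A v \<Longrightarrow> continuous_on A (\<lambda>t. norm_pi_sq n \<pi> (v t))"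
  by (rule continuous_on_is_poly[of n]) auto

lemma poly_qform_inner_pi_square:
  assumes "\<And>i. i < n \<Longrightarrow> is_poly n (\<lambda>x. z x i)"
  shows "poly_qform n (\<lambda>x v. (inner_pi n \<pi> (z x) v)\<^sup>2)"
  using poly_qform_linear_square[of n "\<lambda>i x. \<pi> i * z x i"] assms
  by (simp add: inner_pi_def is_poly_mult is_poly_const mult.assoc)

lemma poly_qform_gram_det:
  assumes "\<And>i. i < n \<Longrightarrow> is_poly n (\<lambda>x. z x i)"
  shows "poly_qform n (\<lambda>x v. gram_det n \<pi> (z x) v)"
proof -
  have "poly_qform n
      (\<lambda>x v. norm_pi_sq n \<pi> (z x) * norm_pi_sq n \<pi> v + (-1) * (inner_pi n \<pi> (z x) v)\<^sup>2)"
    using assms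
    by (intro poly_qform_add poly_qform_mult poly_qform_norm_pi_sq poly_qform_inner_pi_square) auto
  then show ?thesis by (simp add: gram_det_def)
qed

text \<open>Coordinates beyond \<open>n\<close> are pinned to \<open>0\<close>: otherwise these sets would not be compact in
  the product topology of \<^typ>\<open>nat \<Rightarrow> real\<close>.\<close>

definition cube :: "nat \<Rightarrow> real \<Rightarrow> (nat \<Rightarrow> real) set" where
  "cube n N = {x. (\<forall>i<n. \<bar>x i\<bar> \<le> N) \<and> (\<forall>i\<ge>n. x i = 0)}"

definition usphere :: "nat \<Rightarrow> (nat \<Rightarrow> real) \<Rightarrow> (nat \<Rightarrow> real) set" where
  "usphere n \<pi> = {v. norm_pi_sq n \<pi> v = 1 \<and> (\<forall>i\<ge>n. v i = 0)}"

lemma compact_cube: "compact (cube n N)"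
proof -
  have "cube n N = PiE UNIV (\<lambda>i. if i < n then {-N..N} else {0})"
    by (auto simp: cube_def PiE_iff abs_le_iff split: if_splits) (metis minus_le_iff)+
  moreover have "compactin (product_topology (\<lambda>i. euclidean) UNIV)
      (PiE UNIV (\<lambda>i. if i < n then {-N..N} else {0}))"
    unfolding compactin_PiE by auto
  ultimately show ?thesis by (simp add: euclidean_product_topology)
qed

lemma compact_positive_lower_bound:
  fixes f :: "'a::topological_space \<Rightarrow> real"
  assumes "compact X" "continuous_on X f" "\<And>x. x \<in> X \<Longrightarrow> 0 < f x"
  obtains \<eta> where "0 < \<eta>" "\<And>x. x \<in> X \<Longrightarrow> \<eta> \<le> f x"
proof (cases "X = {}")
  case False
  then obtain z where "z \<in> X" "\<And>x. x \<in> X \<Longrightarrow> f z \<le> f x"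
    using continuous_attains_inf[OF assms(1) _ assms(2)] by blast
  then show ?thesis using assms(3) that by blast
qed (use that[of 1] in auto)

lemma compact_penalty:
  fixes p q :: "'a::t2_space \<Rightarrow> real"
  assumes compact_X: "compact X" and cont_p: "continuous_on X p" and cont_q: "continuous_on X q"
    and q_nonneg: "\<And>x. x \<in> X \<Longrightarrow> 0 \<le> q x"
    and p_pos: "\<And>x. x \<in> X \<Longrightarrow> q x = 0 \<Longrightarrow> 0 < p x"
  obtains C \<eta> where "0 \<le> C" "0 < \<eta>" "\<And>x. x \<in> X \<Longrightarrow> \<eta> \<le> p x + C * q x"
proof -
  define Z where "Z = X \<inter> (X \<inter> p -` {..0})"
  have compact_Z: "compact Z" unfolding Z_def
    by (intro compact_Int_closed compact_X continuous_closed_preimage cont_p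
        compact_imp_closed closed_atMost)
  have "0 < q x" if "x \<in> Z" for x
    using that q_nonneg[of x] p_pos[of x] by (force simp: Z_def)
  then obtain \<delta> where q_lower: "0 < \<delta>" "\<And>x. x \<in> Z \<Longrightarrow> \<delta> \<le> q x"
    using compact_positive_lower_bound[OF compact_Z continuous_on_subset[OF cont_q]]
    by (auto simp: Z_def)
  obtain B where p_bound: "0 < B" "\<And>x. x \<in> X \<Longrightarrow> \<bar>p x\<bar> \<le> B"
    using compact_imp_bounded[OF compact_continuous_image[OF cont_p compact_X]]
    by (auto simp: bounded_pos)
  define C where "C = 2 * B / \<delta>"
  have C_pos: "0 < C" using p_bound q_lower by (simp add: C_def)
  have "0 < p x + C * q x" if x_mem: "x \<in> X" for x
  proof (cases "x \<in> Z")
    case True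
    have "2 * B = C * \<delta>" using q_lower by (simp add: C_def)
    also have "\<dots> \<le> C * q x" using C_pos q_lower(2)[OF True] by simp
    finally show ?thesis using p_bound(1) p_bound(2)[OF x_mem] by linarith
  next
    case False
    then have "0 < p x" using x_mem by (auto simp: Z_def)
    then show ?thesis using C_pos q_nonneg[OF x_mem] by (simp add: add_pos_nonneg)
  qed
  moreover have "continuous_on X (\<lambda>x. p x + C * q x)" by (intro continuous_intros cont_p cont_q)
  ultimately obtain \<eta> where "0 < \<eta>" "\<And>x. x \<in> X \<Longrightarrow> \<eta> \<le> p x + C * q x"
    using compact_positive_lower_bound[OF compact_X, of "\<lambda>x. p x + C * q x"] by blast
  with C_pos show ?thesis by (intro that[of C \<eta>]) auto
qed

locale positive_weights =
  fixes n :: nat and \<pi> :: "nat \<Rightarrow> real"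
  assumes pos: "\<And>i. i < n \<Longrightarrow> 0 < \<pi> i"
begin

lemma weighted_square_nonneg: "i < n \<Longrightarrow> 0 \<le> \<pi> i * r\<^sup>2"
  using pos[of i] by simp

lemma norm_nonneg: "0 \<le> norm_pi_sq n \<pi> v"
  unfolding norm_pi_sq_def by (auto intro!: sum_nonneg weighted_square_nonneg)

lemma norm_eq_0_iff: "norm_pi_sq n \<pi> v = 0 \<longleftrightarrow> (\<forall>i<n. v i = 0)"
proof -
  have "norm_pi_sq n \<pi> v = 0 \<longleftrightarrow> (\<forall>i\<in>{..<n}. \<pi> i * (v i)\<^sup>2 = 0)"
    unfolding norm_pi_sq_def by (intro sum_nonneg_eq_0_iff) (auto intro!: weighted_square_nonneg)
  then show ?thesis using pos by force
qed

definition radius :: real where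
  "radius = 1 + (\<Sum>i<n. 1 / \<pi> i)"

lemma radius_ge_1: "1 \<le> radius"
  using pos by (auto simp: radius_def less_imp_le intro!: sum_nonneg)

lemma radius_pos: "0 < radius"
  using radius_ge_1 by simp

lemma radius_square_weight:
  assumes "i < n"
  shows "1 \<le> radius\<^sup>2 * \<pi> i"
proof -
  have "1 / \<pi> i \<le> (\<Sum>i<n. 1 / \<pi> i)"
    using assms pos by (intro member_le_sum) (auto intro: less_imp_le)
  then have "1 / \<pi> i \<le> radius" by (simp add: radius_def)
  also have "radius \<le> radius\<^sup>2" using radius_ge_1 by (simp add: power2_eq_square)
  finally show ?thesis using pos[OF assms] by (simp add: field_simps)
qed

lemma abs_le_radius:
  assumes "norm_pi_sq n \<pi> v = 1" "i < n"
  shows "\<bar>v i\<bar> \<le> radius"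
proof -
  have "(v i)\<^sup>2 \<le> radius\<^sup>2 * (\<pi> i * (v i)\<^sup>2)"
    using mult_right_mono[OF radius_square_weight[OF assms(2)], of "(v i)\<^sup>2"]
    by (simp add: mult.assoc)
  also have "\<dots> \<le> radius\<^sup>2 * norm_pi_sq n \<pi> v"
    unfolding norm_pi_sq_def using assms(2)
    by (intro mult_left_mono member_le_sum) (auto intro!: weighted_square_nonneg)
  finally show ?thesis
    using assms(1) radius_pos abs_le_square_iff[of "v i" radius] by simp
qed

lemma usphere_nonzero: "v \<in> usphere n \<pi> \<Longrightarrow> \<exists>i<n. v i \<noteq> 0"
  using norm_eq_0_iff[of v] by (auto simp: usphere_def)

lemma compact_usphere: "compact (usphere n \<pi>)"
proof -
  have "usphere n \<pi> = cube n radius \<inter> (cube n radius \<inter> norm_pi_sq n \<pi> -` {1})"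
    by (auto simp: usphere_def cube_def abs_le_radius)
  moreover have "continuous_on (cube n radius) (norm_pi_sq n \<pi>)"
    by (rule continuous_on_norm_pi_sq[OF continuous_on_id])
  ultimately show ?thesis
    by (simp only:) (intro compact_Int_closed compact_cube continuous_closed_preimage
        compact_imp_closed[OF compact_cube] closed_singleton)
qed

lemma homogeneous_lower_bound:
  assumes scale: "\<And>t v. F (\<lambda>i. t * v i) = t\<^sup>2 * F v"
    and cong: "\<And>v w. (\<And>i. i < n \<Longrightarrow> v i = w i) \<Longrightarrow> F v = F w"
    and bound: "\<And>v. v \<in> usphere n \<pi> \<Longrightarrow> \<eta> \<le> F v"
  shows "\<eta> * norm_pi_sq n \<pi> v \<le> F v"
proof (cases "norm_pi_sq n \<pi> v = 0")
  case True
  then have "F v = F (\<lambda>i. 0 * v i)" by (intro cong) (auto simp: norm_eq_0_iff)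
  then show ?thesis using scale[of 0 v] True by simp
next
  case False
  define r where "r = sqrt (norm_pi_sq n \<pi> v)"
  have r_norm: "0 < r" "r\<^sup>2 = norm_pi_sq n \<pi> v" using False norm_nonneg[of v] by (auto simp: r_def)
  define u where "u = (\<lambda>i. if i < n then 1 / r * v i else 0)"
  have "norm_pi_sq n \<pi> u = norm_pi_sq n \<pi> (\<lambda>i. 1 / r * v i)"
    by (intro norm_pi_sq_cong) (simp add: u_def)
  also have "\<dots> = 1"
    unfolding norm_pi_sq_scale using r_norm(1) by (simp add: power_divide flip: r_norm(2))
  finally have "\<eta> \<le> F u" by (intro bound) (simp add: usphere_def u_def)
  then have "r\<^sup>2 * \<eta> \<le> r\<^sup>2 * F u" by (simp add: mult_left_mono)
  also have "r\<^sup>2 * F u = F (\<lambda>i. r * u i)" by (rule scale[symmetric])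
  also have "\<dots> = F v" using r_norm(1) by (intro cong) (simp add: u_def)
  finally show ?thesis by (simp add: r_norm(2) mult.commute)
qed

text \<open>On the sphere, \<open>2 r (r + c x\<^sub>i) = (r + c x\<^sub>i)\<^sup>2 + (r\<^sup>2 \<parallel>x\<parallel>\<^sup>2 - x\<^sub>i\<^sup>2)\<close> for
  \<open>c = \<plusminus>1\<close> and the radius \<open>r\<close>.\<close>
lemma sos_mod_radius_plus:
  assumes i_less: "i < n" and sign: "c\<^sup>2 = 1"
  shows "sos_mod n \<pi> (\<lambda>x. radius + c * x i)"
proof (rule sos_modI)
  let ?w = "\<lambda>j. radius\<^sup>2 * \<pi> j - (if j = i then 1 else 0)"
  let ?r = "\<lambda>x. 1 / (2 * radius) * ((radius + c * x i)\<^sup>2 + (\<Sum>j<n. ?w j * (x j)\<^sup>2))"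
  show "poly_sos n ?r"
  proof (intro poly_sos_mult poly_sos_add poly_sos_sum poly_sos_const poly_sos_square)
    fix j assume "j \<in> {..<n}"
    then show "0 \<le> ?w j" using radius_square_weight[of j] by auto
  qed (use radius_pos i_less in auto)
  show "is_poly n (\<lambda>x. - (radius / 2))" by auto
  fix x :: "nat \<Rightarrow> real"
  have "(\<Sum>j<n. ?w j * (x j)\<^sup>2) = radius\<^sup>2 * norm_pi_sq n \<pi> x - (\<Sum>j<n. if j = i then (x j)\<^sup>2 else 0)"
    unfolding norm_pi_sq_def sum_distrib_left sum_subtractf[symmetric]
    by (intro sum.cong refl) (simp add: algebra_simps)
  then have rest: "(\<Sum>j<n. ?w j * (x j)\<^sup>2) = radius\<^sup>2 * norm_pi_sq n \<pi> x - (x i)\<^sup>2"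
    using i_less by simp
  have "(radius + c * x i)\<^sup>2 = radius\<^sup>2 + 2 * radius * c * x i + (x i)\<^sup>2"
    using sign by (simp add: power2_sum power_mult_distrib)
  then show "radius + c * x i = ?r x + - (radius / 2) * (norm_pi_sq n \<pi> x - 1)"
    unfolding rest using radius_pos by (simp add: field_simps power2_eq_square)
qed

definition unit_coords :: "(nat \<Rightarrow> real) \<Rightarrow> nat \<Rightarrow> real" where
  "unit_coords x i = (radius + x i) / (2 * radius)"

lemma sos_mod_Bernstein:
  assumes "i < n"
  shows "sos_mod n \<pi> (\<lambda>x. Bernstein m k (unit_coords x i))"
proof -
  have "1 - (radius + x i) / (2 * radius) = 1 / (2 * radius) * (radius + (- 1) * x i)" for x
    using radius_pos by (simp add: field_simps)
  then have "Bernstein m k (unit_coords x i) = real (m choose k) *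
      (1 / (2 * radius) * (radius + 1 * x i)) ^ k *
      (1 / (2 * radius) * (radius + (- 1) * x i)) ^ (m - k)" for x
    unfolding Bernstein_def unit_coords_def by simp
  then show ?thesis
    using radius_pos assms
    by (simp only:) (intro sos_mod_mult sos_mod_power sos_mod_const sos_mod_radius_plus; simp)
qed

lemma poly_qform_cube_lower_bound:
  assumes G_form: "poly_qform n G"
    and G_pos: "\<And>x v. x \<in> cube n N \<Longrightarrow> v \<in> usphere n \<pi> \<Longrightarrow> 0 < G x v"
  obtains \<eta> where "0 < \<eta>"
    and "\<And>x v. (\<And>i. i < n \<Longrightarrow> \<bar>x i\<bar> \<le> N) \<Longrightarrow> \<eta> * norm_pi_sq n \<pi> v \<le> G x v"
proof -
  obtain \<eta> where eta_lower: "0 < \<eta>" "\<And>z. z \<in> cube n N \<times> usphere n \<pi> \<Longrightarrow> \<eta> \<le> G (fst z) (snd z)"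
  proof (rule compact_positive_lower_bound)
    show "compact (cube n N \<times> usphere n \<pi>)" by (intro compact_Times compact_cube compact_usphere)
    show "continuous_on (cube n N \<times> usphere n \<pi>) (\<lambda>z. G (fst z) (snd z))"
      by (intro continuous_on_poly_qform[OF G_form] continuous_intros)
  qed (use G_pos in auto)
  have "\<eta> * norm_pi_sq n \<pi> v \<le> G x v" if x_bound: "\<And>i. i < n \<Longrightarrow> \<bar>x i\<bar> \<le> N" for x v
  proof -
    define x' where "x' = (\<lambda>i. if i < n then x i else 0)"
    have x'_mem: "x' \<in> cube n N" using x_bound by (auto simp: cube_def x'_def)
    have "\<eta> * norm_pi_sq n \<pi> v \<le> G x' v"
    proof (rule homogeneous_lower_bound)
      show "\<eta> \<le> G x' v" if "v \<in> usphere n \<pi>" for v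
        using eta_lower(2)[of "(x', v)"] x'_mem that by simp
    qed (auto intro: poly_qform_scale[OF G_form] poly_qform_cong[OF G_form])
    also have "G x' v = G x v" by (rule poly_qform_cong[OF G_form]) (auto simp: x'_def)
    finally show ?thesis .
  qed
  with eta_lower(1) that show ?thesis by blast
qed

lemma pos_def_if_near_bounded_below:
  assumes lower: "\<And>v. \<eta> * norm_pi_sq n \<pi> v \<le> H v" and "0 < \<eta>"
    and near: "\<And>v. \<bar>quad_form n A v - H v\<bar> \<le> e * (\<Sum>i<n. \<bar>v i\<bar>)\<^sup>2"
    and e_small: "0 \<le> e" "e * (real n * radius)\<^sup>2 \<le> \<eta> / 2"
  shows "pos_def n A"
  unfolding pos_def_def
proof (intro allI impI)
  fix v :: "nat \<Rightarrow> real" assume "\<exists>i<n. v i \<noteq> 0"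
  then have v_norm_pos: "0 < norm_pi_sq n \<pi> v" using norm_eq_0_iff[of v] norm_nonneg[of v] by force
  have "\<eta> / 2 * norm_pi_sq n \<pi> v \<le> quad_form n A v"
  proof (rule homogeneous_lower_bound)
    fix u assume "u \<in> usphere n \<pi>"
    then have norm_u: "norm_pi_sq n \<pi> u = 1" by (simp add: usphere_def)
    have "(\<Sum>i<n. \<bar>u i\<bar>) \<le> (\<Sum>i<n. radius)"
      using norm_u by (intro sum_mono abs_le_radius) auto
    then have "(\<Sum>i<n. \<bar>u i\<bar>)\<^sup>2 \<le> (real n * radius)\<^sup>2"
      by (intro power_mono) (auto intro!: sum_nonneg)
    then have "e * (\<Sum>i<n. \<bar>u i\<bar>)\<^sup>2 \<le> \<eta> / 2"
      using e_small mult_left_mono order.trans by blast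
    moreover have "\<eta> \<le> H u" using lower[of u] norm_u by simp
    ultimately show "\<eta> / 2 \<le> quad_form n A u" using near[of u] by linarith
  qed (auto intro: quad_form_scale quad_form_cong)
  moreover have "0 < \<eta> / 2 * norm_pi_sq n \<pi> v" using v_norm_pos assms(2) by simp
  ultimately show "0 < quad_form n A v" by linarith
qed

lemma poly_qform_pos_Bernstein:
  assumes G_form: "poly_qform n G"
    and G_pos: "\<And>x v. x \<in> cube n radius \<Longrightarrow> v \<in> usphere n \<pi> \<Longrightarrow> 0 < G x v"
  obtains m C where "\<And>K. K \<in> multi_index n m \<Longrightarrow> pos_def n (C K)"
    and "\<And>x v. G x v = (\<Sum>K\<in>multi_index n m.
      multi_Bernstein n m K (unit_coords x) * quad_form n (C K) v)"
proof -
  obtain \<eta> where eta_pos: "0 < \<eta>"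
    and lower: "\<And>x v. (\<And>i. i < n \<Longrightarrow> \<bar>x i\<bar> \<le> radius) \<Longrightarrow> \<eta> * norm_pi_sq n \<pi> v \<le> G x v"
    using poly_qform_cube_lower_bound[OF G_form G_pos] by blast
  define H where "H = (\<lambda>u. G (\<lambda>i. radius * (2 * u i - 1)))"
  define e where "e = \<eta> / (2 * (real n * radius + 1)\<^sup>2)"
  have scale_pos: "0 < real n * radius + 1" using radius_pos by (intro add_nonneg_pos) auto
  then have e_pos: "0 < e" using eta_pos by (simp add: e_def)
  have "e * (real n * radius)\<^sup>2 \<le> e * (real n * radius + 1)\<^sup>2"
    using e_pos radius_pos by (intro mult_left_mono power_mono) auto
  also have "\<dots> = \<eta> / 2"
    using scale_pos by (simp add: e_def)
  finally have e_small: "e * (real n * radius)\<^sup>2 \<le> \<eta> / 2" .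
  have "poly_qform n H" unfolding H_def by (rule poly_qform_compose[OF G_form]) auto
  from eventually_happens[OF eventually_poly_qform_Bernstein[OF this e_pos]]
  obtain m C where H_expansion: "\<And>u v. H u v
      = (\<Sum>K\<in>multi_index n m. multi_Bernstein n m K u * quad_form n (C K) v)"
    and near: "\<And>K v. K \<in> multi_index n m \<Longrightarrow>
      \<bar>quad_form n (C K) v - H (grid_point m K) v\<bar> \<le> e * (\<Sum>i<n. \<bar>v i\<bar>)\<^sup>2"
    by auto
  show ?thesis
  proof
    fix K assume K_mem: "K \<in> multi_index n m"
    have "\<bar>radius * (2 * grid_point m K i - 1)\<bar> \<le> radius * 1" if "i < n" for i
      unfolding abs_mult using grid_point_unit_cube[OF K_mem that] radius_pos
      by (intro mult_mono) auto
    then show "pos_def n (C K)"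
      using pos_def_if_near_bounded_below[OF _ eta_pos near[OF K_mem] _ e_small] e_pos lower
      by (simp add: H_def)
  next
    fix x v
    have "G x v = H (unit_coords x) v"
      using radius_pos by (simp add: H_def unit_coords_def field_simps)
    also note H_expansion
    finally show "G x v = (\<Sum>K\<in>multi_index n m.
        multi_Bernstein n m K (unit_coords x) * quad_form n (C K) v)" .
  qed
qed

theorem poly_qform_pos_sos_mod:
  assumes "poly_qform n G"
    and "\<And>x v. x \<in> cube n radius \<Longrightarrow> v \<in> usphere n \<pi> \<Longrightarrow> 0 < G x v"
    and y_poly: "\<And>i. i < n \<Longrightarrow> is_poly n (\<lambda>x. y x i)"
  shows "sos_mod n \<pi> (\<lambda>x. G x (y x))"
proof -
  obtain m C where C_pos_def: "\<And>K. K \<in> multi_index n m \<Longrightarrow> pos_def n (C K)"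
    and G_expansion: "\<And>x v. G x v = (\<Sum>K\<in>multi_index n m.
      multi_Bernstein n m K (unit_coords x) * quad_form n (C K) v)"
    using poly_qform_pos_Bernstein assms(1,2) by blast
  have "sos_mod n \<pi>
      (\<lambda>x. multi_Bernstein n m K (unit_coords x) * quad_form n (C K) (y x))"
    if K_mem: "K \<in> multi_index n m" for K
  proof (rule sos_mod_mult)
    show "sos_mod n \<pi> (\<lambda>x. multi_Bernstein n m K (unit_coords x))"
      unfolding multi_Bernstein_def by (intro sos_mod_prod sos_mod_Bernstein) auto
    obtain ls where "\<And>v. quad_form n (C K) v = (\<Sum>l\<leftarrow>ls. (\<Sum>i<n. l i * v i)\<^sup>2)"
      using pos_def_sum_squares[OF C_pos_def[OF K_mem]] by blast
    then show "sos_mod n \<pi> (\<lambda>x. quad_form n (C K) (y x))"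
      using y_poly by (auto intro!: sos_mod_sos poly_sos_sum_list poly_sos_square)
  qed
  then show ?thesis unfolding G_expansion by (rule sos_mod_sum)
qed

end

section \<open>Certificates for polynomials with a nondegenerate interior zero\<close>

lemma mult_power_one_minus_le_1:
  fixes u :: real
  assumes "0 \<le> u" "u \<le> 1"
  shows "real m * (u * (1 - u) ^ m) \<le> 1"
proof -
  have "real m * (u * (1 - u) ^ m) \<le> (1 - u) ^ m * (1 + real m * u)"
    using assms by (simp add: algebra_simps)
  also have "\<dots> \<le> (1 - u) ^ m * (1 + u) ^ m"
    using assms by (intro mult_left_mono Bernoulli_inequality) auto
  also have "\<dots> = (1 - u\<^sup>2) ^ m"
    by (simp add: power_mult_distrib[symmetric] algebra_simps power2_eq_square)
  also have "\<dots> \<le> 1" using assms by (intro power_le_one) (auto simp: power_le_one)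
  finally show ?thesis .
qed

lemma linear_minus_le_power:
  fixes C \<eta> N r :: real
  assumes "0 < \<eta>" "0 < N" "0 \<le> r" and m_large: "C\<^sup>2 * N \<le> real m * \<eta>"
  shows "C * r - \<eta> \<le> r * (1 + r / N) ^ m"
proof -
  have "1 + real m * (r / N) \<le> (1 + r / N) ^ m"
    using order.trans[of "-1" 0 "r / N"] assms by (intro Bernoulli_inequality) auto
  then have "r * (real m * (r / N)) \<le> r * (1 + r / N) ^ m"
    using assms(3) by (intro mult_left_mono) auto
  moreover have "C * r - \<eta> \<le> r * (real m * (r / N))"
  proof (cases "m = 0")
    case True
    then show ?thesis using m_large assms by (simp add: mult_le_0_iff)
  next
    case False
    define q where "q = real m / N"
    have q_large: "0 < q" "C\<^sup>2 \<le> q * \<eta>"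
      using m_large assms(2) False by (auto simp: q_def field_simps)
    have "2 * (q * r * C) \<le> (q * r)\<^sup>2 + C\<^sup>2"
      using sum_squares_bound[of "q * r" C] by (simp add: mult.assoc)
    moreover have "0 \<le> (q * r)\<^sup>2 + C\<^sup>2" by simp
    ultimately have "q * r * C \<le> (q * r)\<^sup>2 + C\<^sup>2" by linarith
    also have "\<dots> \<le> q * (q * r\<^sup>2 + \<eta>)"
      using q_large(2) by (simp add: power2_eq_square algebra_simps)
    finally have "C * r \<le> q * r\<^sup>2 + \<eta>" using q_large(1) by (simp add: mult.assoc mult.commute[of r])
    then show ?thesis by (simp add: q_def power2_eq_square mult_ac)
  qed
  ultimately show ?thesis by linarith
qed

text \<open>The upper bound is \<open>- t \<sigma>(t)\<close> for a square \<open>\<sigma>\<close>, and so can be compensated within the quadratic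
  module.\<close>
lemma orthant_penalty:
  fixes C \<eta> N :: real
  assumes "0 < \<eta>" "0 < N"
  obtains k where "\<And>t. \<bar>t\<bar> \<le> N \<Longrightarrow> C * max 0 (- t) - \<eta> \<le> - t * ((1 - t / N) ^ k)\<^sup>2"
proof -
  obtain k :: nat where "(C\<^sup>2 + 1) * N / \<eta> < real k" using reals_Archimedean2 by blast
  then have k_large: "C\<^sup>2 * N + N < real k * \<eta>" using assms by (simp add: field_simps)
  define m where "m = k * 2"
  have "real k * \<eta> \<le> real m * \<eta>" using assms by (simp add: m_def)
  moreover have "0 \<le> C\<^sup>2 * N" using assms by simp
  ultimately have m_large: "C\<^sup>2 * N \<le> real m * \<eta>" "N \<le> real m * \<eta>" using k_large assms by linarith+
  have "C * max 0 (- t) - \<eta> \<le> - t * (1 - t / N) ^ m" if t_bound: "\<bar>t\<bar> \<le> N" for t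
  proof (cases "0 \<le> t")
    case True
    have "real m * (t / N * (1 - t / N) ^ m) \<le> 1"
      using True t_bound assms by (intro mult_power_one_minus_le_1) auto
    then have "real m * (t * (1 - t / N) ^ m) \<le> N"
      using assms by (simp add: field_simps)
    also note m_large(2)
    finally have "t * (1 - t / N) ^ m \<le> \<eta>"
      using m_large(2) assms by (cases "m = 0") auto
    then show ?thesis using True by simp
  next
    case False
    then show ?thesis using linear_minus_le_power[OF assms, of "- t" C m] m_large(1) by simp
  qed
  then show ?thesis using that[of k] by (simp add: m_def power_mult)
qed

lemma nonneg_of_right_limit:
  fixes F :: "real \<Rightarrow> real"
  assumes "isCont F a" "\<forall>\<^sub>F t in at_right a. 0 \<le> F t"
  shows "0 \<le> F a"
proof -
  have "(F \<longlongrightarrow> F a) (at_right a)"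
    using assms(1) unfolding isCont_def by (rule filterlim_mono) (auto intro: at_le)
  from tendsto_lowerbound[OF this assms(2)] show ?thesis by simp
qed

locale interior_sphere_point = positive_weights +
  fixes e :: "nat \<Rightarrow> real"
  assumes e_pos: "\<And>i. i < n \<Longrightarrow> 0 < e i" and norm_e: "norm_pi_sq n \<pi> e = 1"
begin

lemma n_pos: "0 < n"
  using norm_e by (cases n) (auto simp: norm_pi_sq_def)

text \<open>A tangent direction \<open>v\<close> is tilted inwards to \<open>v - s \<parallel>v\<parallel>\<^sup>2 e\<close>; the ray from \<open>e\<close> in that direction
  meets the sphere again at parameter \<open>2 s / (1 + s\<^sup>2 \<parallel>v\<parallel>\<^sup>2)\<close>.\<close>
lemma norm_tilted_ray_endpoint:
  assumes tangent: "inner_pi n \<pi> e v = 0" and denom: "1 + norm_pi_sq n \<pi> v * s\<^sup>2 \<noteq> 0"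
  shows "norm_pi_sq n \<pi>
    (\<lambda>i. e i + 2 * s / (1 + norm_pi_sq n \<pi> v * s\<^sup>2) * (v i - norm_pi_sq n \<pi> v * s * e i)) = 1"
proof -
  define r where "r = norm_pi_sq n \<pi> v"
  define \<tau> where "\<tau> = 2 * s / (1 + r * s\<^sup>2)"
  define w where "w = (\<lambda>i. v i - r * s * e i)"
  have "norm_pi_sq n \<pi> w = r * (1 + r * s\<^sup>2)"
    using norm_pi_sq_combination[of n \<pi> 1 v "- (r * s)" e] tangent
    by (simp add: w_def norm_e r_def inner_pi_commute power2_eq_square algebra_simps)
  moreover have "inner_pi n \<pi> e w = - (r * s)"
    using inner_pi_combination[of n \<pi> e 1 v "- (r * s)" e] tangent
    by (simp add: w_def norm_e inner_pi_self)
  ultimately have "norm_pi_sq n \<pi> (\<lambda>i. e i + \<tau> * w i)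
      = 1 - 2 * \<tau> * (r * s) + \<tau> * (\<tau> * (1 + r * s\<^sup>2)) * r"
    using norm_pi_sq_combination[of n \<pi> 1 e \<tau> w]
    by (simp add: norm_e power2_eq_square mult_ac)
  also have "\<tau> * (1 + r * s\<^sup>2) = 2 * s" using denom by (simp add: \<tau>_def r_def)
  finally show ?thesis by (simp add: \<tau>_def w_def r_def)
qed

lemma tangent_curve:
  assumes tangent: "inner_pi n \<pi> e v = 0"
  obtains \<tau> :: "real \<Rightarrow> real" and w :: "real \<Rightarrow> nat \<Rightarrow> real"
  where "\<tau> 0 = 0" "w 0 = v" "continuous_on UNIV \<tau>" "continuous_on UNIV w"
    and "\<forall>\<^sub>F s in at_right 0. 0 < \<tau> s \<and> (\<lambda>i. e i + \<tau> s * w s i) \<in> S_pi n \<pi>"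
proof
  define r where "r = norm_pi_sq n \<pi> v"
  define \<tau> where "\<tau> = (\<lambda>s :: real. 2 * s / (1 + r * s\<^sup>2))"
  define w where "w = (\<lambda>s i. v i - r * s * e i)"
  show "\<tau> 0 = 0" "w 0 = v" by (simp_all add: \<tau>_def w_def)
  have denom: "0 < 1 + r * s\<^sup>2" for s
    using norm_nonneg[of v] by (simp add: r_def add_pos_nonneg)
  show cont_\<tau>: "continuous_on UNIV \<tau>"
    unfolding \<tau>_def using denom by (intro continuous_intros) (simp add: less_imp_neq[symmetric])
  show cont_w: "continuous_on UNIV w"
    unfolding w_def by (intro continuous_on_coordinatewise_then_product continuous_intros)
  have "\<forall>\<^sub>F s in at_right 0. \<forall>i\<in>{..<n}. 0 < e i + \<tau> s * w s i"
  proof (intro eventually_ball_finite ballI)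
    fix i assume i_less: "i \<in> {..<n}"
    have "continuous_on UNIV (\<lambda>s. e i + \<tau> s * w s i)"
      by (intro continuous_intros cont_\<tau> continuous_on_product_then_coordinatewise[OF cont_w])
    then have "((\<lambda>s. e i + \<tau> s * w s i) \<longlongrightarrow> e i + \<tau> 0 * w 0 i) (at 0)"
      by (simp add: continuous_on_eq_continuous_at isCont_def)
    then have "((\<lambda>s. e i + \<tau> s * w s i) \<longlongrightarrow> e i) (at_right 0)"
      by (rule filterlim_mono) (auto intro: at_le simp: \<tau>_def)
    then show "\<forall>\<^sub>F s in at_right 0. 0 < e i + \<tau> s * w s i"
      using e_pos i_less by (auto dest: order_tendstoD(1))
  qed auto
  then show "\<forall>\<^sub>F s in at_right 0. 0 < \<tau> s \<and> (\<lambda>i. e i + \<tau> s * w s i) \<in> S_pi n \<pi>"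
    using eventually_at_right_less[of 0]
  proof eventually_elim
    case (elim s)
    moreover have "norm_pi_sq n \<pi> (\<lambda>i. e i + \<tau> s * w s i) = 1"
      using norm_tilted_ray_endpoint[OF tangent] denom[of s] by (simp add: \<tau>_def w_def r_def)
    ultimately show ?case using denom[of s] by (auto simp: S_pi_def \<tau>_def less_imp_le)
  qed
qed

lemma tangent_limit_nonneg:
  fixes F :: "real \<Rightarrow> (nat \<Rightarrow> real) \<Rightarrow> real"
  assumes cont: "continuous_on UNIV (\<lambda>z. F (fst z) (snd z))"
    and nonneg: "\<And>t w. 0 < t \<Longrightarrow> (\<lambda>i. e i + t * w i) \<in> S_pi n \<pi> \<Longrightarrow> 0 \<le> F t w"
    and tangent: "inner_pi n \<pi> e v = 0"
  shows "0 \<le> F 0 v"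
proof -
  obtain \<tau> :: "real \<Rightarrow> real" and w where start: "\<tau> 0 = 0" "w 0 = v"
    and cont_curve: "continuous_on UNIV \<tau>" "continuous_on UNIV w"
    and on_sphere: "\<forall>\<^sub>F s in at_right 0. 0 < \<tau> s \<and> (\<lambda>i. e i + \<tau> s * w s i) \<in> S_pi n \<pi>"
    using tangent_curve[OF tangent] by blast
  have "isCont (\<lambda>s. F (\<tau> s) (w s)) 0"
    using continuous_on_compose2[OF cont continuous_on_Pair[OF cont_curve]]
    by (simp add: continuous_on_eq_continuous_at)
  moreover have "\<forall>\<^sub>F s in at_right 0. 0 \<le> F (\<tau> s) (w s)"
    using on_sphere by (rule eventually_mono) (auto intro: nonneg)
  ultimately have "0 \<le> F (\<tau> 0) (w 0)"
    by (intro nonneg_of_right_limit[where F = "\<lambda>s. F (\<tau> s) (w s)" and a = 0])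
  then show ?thesis by (simp add: start)
qed

lemma gradient_parallel:
  assumes G_form: "poly_qform n G"
    and nonneg: "\<And>x. x \<in> S_pi n \<pi> \<Longrightarrow> 0 \<le> (\<Sum>i<n. D i * (x i - e i)) + G x (\<lambda>i. x i - e i)"
  shows "\<exists>\<mu>. \<forall>v. (\<Sum>i<n. D i * v i) = \<mu> * inner_pi n \<pi> e v"
proof -
  have D_nonneg: "0 \<le> (\<Sum>i<n. D i * v i)" if tangent: "inner_pi n \<pi> e v = 0" for v
  proof -
    have "0 \<le> (\<Sum>i<n. D i * v i) + 0 * G (\<lambda>i. e i + 0 * v i) v"
    proof (rule tangent_limit_nonneg[OF _ _ tangent])
      show "continuous_on UNIV
          (\<lambda>z. (\<Sum>i<n. D i * snd z i) + fst z * G (\<lambda>i. e i + fst z * snd z i) (snd z))"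
        by (intro continuous_intros continuous_on_poly_qform[OF G_form]
            continuous_on_coordinatewise_then_product continuous_on_product_then_coordinatewise)
    next
      fix t w assume t_pos: "0 < t" and x_mem: "(\<lambda>i. e i + t * w i) \<in> S_pi n \<pi>"
      have "t * ((\<Sum>i<n. D i * w i) + t * G (\<lambda>i. e i + t * w i) w)
          = (\<Sum>i<n. D i * (t * w i)) + G (\<lambda>i. e i + t * w i) (\<lambda>i. t * w i)"
        unfolding poly_qform_scale[OF G_form]
        by (simp add: sum_distrib_left power2_eq_square algebra_simps)
      also have "0 \<le> \<dots>" using nonneg[OF x_mem] by simp
      finally show "0 \<le> (\<Sum>i<n. D i * w i) + t * G (\<lambda>i. e i + t * w i) w"
        using t_pos by (simp add: zero_le_mult_iff)
    qed
    then show ?thesis by simp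
  qed
  have D_tangent: "(\<Sum>i<n. D i * v i) = 0" if "inner_pi n \<pi> e v = 0" for v
    using D_nonneg[of v] D_nonneg[of "\<lambda>i. - v i"] that by (simp add: inner_pi_def sum_negf)
  have "(\<Sum>i<n. D i * v i) = (\<Sum>i<n. D i * e i) * inner_pi n \<pi> e v" for v
  proof -
    have "inner_pi n \<pi> e (\<lambda>i. 1 * v i + - inner_pi n \<pi> e v * e i) = 0"
      unfolding inner_pi_combination by (simp add: inner_pi_self norm_e)
    from D_tangent[OF this] show ?thesis
      by (simp add: right_diff_distrib sum_subtractf sum_distrib_left mult_ac)
  qed
  then show ?thesis by blast
qed

lemma norm_minus_1:
  "norm_pi_sq n \<pi> x - 1 = 2 * inner_pi n \<pi> e (\<lambda>i. x i - e i) + norm_pi_sq n \<pi> (\<lambda>i. x i - e i)"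
  using norm_pi_sq_combination[of n \<pi> 1 e 1 "\<lambda>i. x i - e i"] by (simp add: norm_e)

lemma quadratic_growth_normal_form:
  assumes f_zero: "is_poly n f" "f e = 0" and "0 \<le> c"
    and growth: "\<And>x. x \<in> S_pi n \<pi> \<Longrightarrow> c * norm_pi_sq n \<pi> (\<lambda>i. x i - e i) \<le> f x"
  obtains \<mu> G where "poly_qform n G"
    and "\<And>x. f x = G x (\<lambda>i. x i - e i) + \<mu> * (norm_pi_sq n \<pi> x - 1)"
    and "\<And>v. inner_pi n \<pi> e v = 0 \<Longrightarrow> c * norm_pi_sq n \<pi> v \<le> G e v"
proof -
  obtain D H where H_form: "poly_qform n H"
    and Taylor: "\<And>x. f x = (\<Sum>i<n. D i * (x i - e i)) + H x (\<lambda>i. x i - e i)"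
    using is_poly_Taylor2[OF f_zero(1), where e = e, unfolded f_zero(2) add_0_left] by blast
  have "0 \<le> (\<Sum>i<n. D i * (x i - e i)) + H x (\<lambda>i. x i - e i)" if "x \<in> S_pi n \<pi>" for x
    unfolding Taylor[symmetric]
    using growth[OF that] mult_nonneg_nonneg[OF \<open>0 \<le> c\<close> norm_nonneg] by (rule order.trans[rotated])
  from gradient_parallel[OF H_form this]
  obtain \<mu> where gradient: "\<And>v. (\<Sum>i<n. D i * v i) = \<mu> * inner_pi n \<pi> e v" by blast
  define G where "G = (\<lambda>x v. H x v + (- \<mu> / 2) * norm_pi_sq n \<pi> v)"
  have G_form: "poly_qform n G"
    unfolding G_def by (intro poly_qform_add poly_qform_mult H_form poly_qform_norm_pi_sq) auto
  have f_eq: "f x = G x (\<lambda>i. x i - e i) + \<mu> / 2 * (norm_pi_sq n \<pi> x - 1)" for x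
    unfolding Taylor gradient norm_minus_1 G_def by (simp add: algebra_simps)
  have "c * norm_pi_sq n \<pi> v \<le> G e v" if tangent: "inner_pi n \<pi> e v = 0" for v
  proof -
    have "0 \<le> G (\<lambda>i. e i + 0 * v i) v - c * norm_pi_sq n \<pi> v"
    proof (rule tangent_limit_nonneg[OF _ _ tangent])
      show "continuous_on UNIV
          (\<lambda>z. G (\<lambda>i. e i + fst z * snd z i) (snd z) - c * norm_pi_sq n \<pi> (snd z))"
        by (intro continuous_intros continuous_on_poly_qform[OF G_form] continuous_on_norm_pi_sq
            continuous_on_coordinatewise_then_product continuous_on_product_then_coordinatewise)
    next
      fix t w assume t_pos: "0 < t" and x_mem: "(\<lambda>i. e i + t * w i) \<in> S_pi n \<pi>"
      have "t\<^sup>2 * (c * norm_pi_sq n \<pi> w) \<le> f (\<lambda>i. e i + t * w i)"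
        using growth[OF x_mem] by (simp add: norm_pi_sq_scale mult_ac)
      also have "\<dots> = t\<^sup>2 * G (\<lambda>i. e i + t * w i) w"
        using x_mem by (simp add: f_eq S_pi_def poly_qform_scale[OF G_form])
      finally show "0 \<le> G (\<lambda>i. e i + t * w i) w - c * norm_pi_sq n \<pi> w" using t_pos by simp
    qed
    then show ?thesis by simp
  qed
  with that G_form f_eq show ?thesis by blast
qed

text \<open>The Gram determinant forces \<open>v\<close> to be parallel to \<open>x - e\<close>, except at \<open>x = e\<close>, where the first
  summand forces \<open>v\<close> to be tangent to the sphere.\<close>
definition off_diagonal :: "(nat \<Rightarrow> real) \<Rightarrow> (nat \<Rightarrow> real) \<Rightarrow> real" where
  "off_diagonal x v = (inner_pi n \<pi> (\<lambda>i. x i + e i) v)\<^sup>2 + gram_det n \<pi> (\<lambda>i. x i - e i) v"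

lemma poly_qform_off_diagonal: "poly_qform n off_diagonal"
proof -
  have "poly_qform n (\<lambda>x v. (inner_pi n \<pi> (\<lambda>i. x i + e i) v)\<^sup>2 + gram_det n \<pi> (\<lambda>i. x i - e i) v)"
    by (intro poly_qform_add poly_qform_inner_pi_square poly_qform_gram_det) auto
  then show ?thesis by (simp add: off_diagonal_def[abs_def])
qed

lemma off_diagonal_at_diff: "off_diagonal x (\<lambda>i. x i - e i) = (norm_pi_sq n \<pi> x - 1)\<^sup>2"
proof -
  have "inner_pi n \<pi> (\<lambda>i. x i + e i) (\<lambda>i. x i - e i) = norm_pi_sq n \<pi> x - 1"
    unfolding norm_e[symmetric] by (simp add: inner_pi_def norm_pi_sq_def sum_subtractf[symmetric]
        power2_eq_square algebra_simps)
  then show ?thesis by (simp add: off_diagonal_def gram_det_self)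
qed

lemma off_diagonal_nonneg: "norm_pi_sq n \<pi> v = 1 \<Longrightarrow> 0 \<le> off_diagonal x v"
  by (simp add: off_diagonal_def gram_det_unit norm_nonneg)

lemma off_diagonal_eq_0D:
  assumes unit: "norm_pi_sq n \<pi> v = 1" and "off_diagonal x v = 0"
  shows "inner_pi n \<pi> (\<lambda>i. x i + e i) v = 0"
    and "i < n \<Longrightarrow> x i - e i = inner_pi n \<pi> (\<lambda>i. x i - e i) v * v i"
proof -
  have "(inner_pi n \<pi> (\<lambda>i. x i + e i) v)\<^sup>2 = 0
      \<and> norm_pi_sq n \<pi> (\<lambda>i. x i - e i - inner_pi n \<pi> (\<lambda>i. x i - e i) v * v i) = 0"
    using assms(2) unfolding off_diagonal_def gram_det_unit[OF unit]
    by (subst (asm) add_nonneg_eq_0_iff) (auto simp: norm_nonneg)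
  then show "inner_pi n \<pi> (\<lambda>i. x i + e i) v = 0"
    and "i < n \<Longrightarrow> x i - e i = inner_pi n \<pi> (\<lambda>i. x i - e i) v * v i"
    by (auto simp: norm_eq_0_iff)
qed

definition constraint_violation :: "(nat \<Rightarrow> real) \<Rightarrow> real" where
  "constraint_violation x = (norm_pi_sq n \<pi> x - 1)\<^sup>2 + (\<Sum>i<n. max 0 (- x i))"

lemma constraint_violation_nonneg: "0 \<le> constraint_violation x"
  unfolding constraint_violation_def by (intro add_nonneg_nonneg sum_nonneg) auto

lemma constraint_violation_eq_0_iff: "constraint_violation x = 0 \<longleftrightarrow> x \<in> S_pi n \<pi>"
proof -
  have negative_part: "max 0 (- r) = 0 \<longleftrightarrow> 0 \<le> r" for r :: real by linarith
  have "constraint_violation x = 0 \<longleftrightarrow>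
      (norm_pi_sq n \<pi> x - 1)\<^sup>2 = 0 \<and> (\<Sum>i<n. max 0 (- x i)) = 0"
    unfolding constraint_violation_def by (intro add_nonneg_eq_0_iff sum_nonneg) auto
  also have "(\<Sum>i<n. max 0 (- x i)) = 0 \<longleftrightarrow> (\<forall>i\<in>{..<n}. max 0 (- x i) = 0)"
    by (intro sum_nonneg_eq_0_iff) auto
  also have "\<dots> \<longleftrightarrow> (\<forall>i<n. 0 \<le> x i)" using negative_part by auto
  finally show ?thesis by (auto simp: S_pi_def)
qed

lemma continuous_on_constraint_violation:
  assumes "continuous_on A x"
  shows "continuous_on A (\<lambda>t. constraint_violation (x t))"
  unfolding constraint_violation_def
  by (intro continuous_intros continuous_on_norm_pi_sq assms
      continuous_on_product_then_coordinatewise[OF assms])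

lemma form_pos_if_no_penalty:
  assumes G_form: "poly_qform n G" and "0 < c"
    and tangential: "\<And>v. inner_pi n \<pi> e v = 0 \<Longrightarrow> c * norm_pi_sq n \<pi> v \<le> G e v"
    and diagonal: "c * norm_pi_sq n \<pi> (\<lambda>i. x i - e i) \<le> G x (\<lambda>i. x i - e i)"
    and unit: "norm_pi_sq n \<pi> v = 1" and "off_diagonal x v = 0"
  shows "0 < G x v"
proof -
  define t where "t = inner_pi n \<pi> (\<lambda>i. x i - e i) v"
  have orthogonal: "inner_pi n \<pi> (\<lambda>i. x i + e i) v = 0"
    and diff_eq: "\<And>i. i < n \<Longrightarrow> x i - e i = t * v i"
    using off_diagonal_eq_0D[OF unit \<open>off_diagonal x v = 0\<close>] by (auto simp: t_def)
  have "c \<le> G x v"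
  proof (cases "t = 0")
    case True
    then have x_eq: "x i = e i" if "i < n" for i using diff_eq[OF that] by simp
    have "2 * inner_pi n \<pi> e v = inner_pi n \<pi> (\<lambda>i. x i + e i) v"
      by (simp add: x_eq inner_pi_def sum_distrib_left algebra_simps)
    with orthogonal tangential[of v] unit have "c \<le> G e v" by simp
    also have "\<dots> = G x v" by (rule poly_qform_cong[OF G_form]) (simp_all add: x_eq)
    finally show ?thesis .
  next
    case False
    have "t\<^sup>2 * c = c * norm_pi_sq n \<pi> (\<lambda>i. x i - e i)"
      using norm_pi_sq_cong[of n "\<lambda>i. x i - e i" "\<lambda>i. t * v i" \<pi>]
      by (simp add: diff_eq norm_pi_sq_scale unit)
    also note diagonal
    also have "G x (\<lambda>i. x i - e i) = G x (\<lambda>i. t * v i)"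
      by (rule poly_qform_cong[OF G_form]) (simp_all add: diff_eq)
    also have "\<dots> = t\<^sup>2 * G x v" by (rule poly_qform_scale[OF G_form])
    finally show ?thesis using False by simp
  qed
  then show ?thesis using \<open>0 < c\<close> by linarith
qed

lemma penalised_form_lower_bound:
  assumes G_form: "poly_qform n G" and "0 < c"
    and "\<And>v. inner_pi n \<pi> e v = 0 \<Longrightarrow> c * norm_pi_sq n \<pi> v \<le> G e v"
    and "\<And>x. x \<in> S_pi n \<pi> \<Longrightarrow> c * norm_pi_sq n \<pi> (\<lambda>i. x i - e i) \<le> G x (\<lambda>i. x i - e i)"
  shows "\<exists>C. \<exists>\<eta>>0. \<forall>x\<in>cube n N. \<forall>v\<in>usphere n \<pi>.
    \<eta> \<le> G x v + C * (off_diagonal x v + constraint_violation x)"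
proof -
  let ?p = "\<lambda>z. G (fst z) (snd z)"
  let ?q = "\<lambda>z. off_diagonal (fst z) (snd z) + constraint_violation (fst z)"
  obtain C \<eta> where "0 \<le> C" "0 < \<eta>" and "\<And>z. z \<in> cube n N \<times> usphere n \<pi> \<Longrightarrow> \<eta> \<le> ?p z + C * ?q z"
  proof (rule compact_penalty)
    show "compact (cube n N \<times> usphere n \<pi>)" by (intro compact_Times compact_cube compact_usphere)
    show "continuous_on (cube n N \<times> usphere n \<pi>) ?p" "continuous_on (cube n N \<times> usphere n \<pi>) ?q"
      by (intro continuous_intros continuous_on_poly_qform[OF G_form]
          continuous_on_poly_qform[OF poly_qform_off_diagonal] continuous_on_constraint_violation)+
    fix z assume "z \<in> cube n N \<times> usphere n \<pi>"
    then have unit: "norm_pi_sq n \<pi> (snd z) = 1" by (auto simp: usphere_def)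
    show "0 \<le> ?q z"
      by (intro add_nonneg_nonneg off_diagonal_nonneg[OF unit] constraint_violation_nonneg)
    assume "?q z = 0"
    then have off_diagonal: "off_diagonal (fst z) (snd z) = 0" and S_pi: "fst z \<in> S_pi n \<pi>"
      unfolding constraint_violation_eq_0_iff[symmetric]
      by (simp_all add: add_nonneg_eq_0_iff off_diagonal_nonneg[OF unit] constraint_violation_nonneg)
    show "0 < ?p z"
      by (rule form_pos_if_no_penalty[OF G_form \<open>0 < c\<close> assms(3) assms(4)[OF S_pi] unit off_diagonal])
  qed (rule that)
  then show ?thesis by (intro exI[of _ C] exI[of _ \<eta>]) force
qed

lemma cube_orthant_penalty:
  assumes "0 < \<eta>"
  obtains k where "\<And>x. x \<in> cube n radius \<Longrightarrow>
    C * (\<Sum>i<n. max 0 (- x i)) - \<eta> \<le> - (\<Sum>i<n. x i * ((1 - x i / radius) ^ k)\<^sup>2)"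
proof -
  obtain k where penalty: "\<And>t. \<bar>t\<bar> \<le> radius \<Longrightarrow>
      C * max 0 (- t) - \<eta> / real n \<le> - t * ((1 - t / radius) ^ k)\<^sup>2"
    using orthant_penalty[of "\<eta> / real n" radius C] assms n_pos radius_pos by auto
  show ?thesis
  proof
    fix x assume "x \<in> cube n radius"
    have "C * (\<Sum>i<n. max 0 (- x i)) - \<eta> = (\<Sum>i<n. C * max 0 (- x i) - \<eta> / real n)"
      using n_pos by (simp add: sum_subtractf sum_distrib_left)
    also have "\<dots> \<le> (\<Sum>i<n. - x i * ((1 - x i / radius) ^ k)\<^sup>2)"
      using \<open>x \<in> cube n radius\<close> by (intro sum_mono penalty) (auto simp: cube_def)
    finally show "C * (\<Sum>i<n. max 0 (- x i)) - \<eta> \<le> - (\<Sum>i<n. x i * ((1 - x i / radius) ^ k)\<^sup>2)"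
      by (simp add: sum_negf)
  qed
qed

lemma quadratic_module_if_penalised_form_pos:
  assumes G_form: "poly_qform n G"
    and f_eq: "\<And>x. f x = G x (\<lambda>i. x i - e i) + \<mu> * (norm_pi_sq n \<pi> x - 1)"
    and "0 < \<eta>" and bound: "\<And>x v. x \<in> cube n radius \<Longrightarrow> v \<in> usphere n \<pi> \<Longrightarrow>
      \<eta> \<le> G x v + C * (off_diagonal x v + constraint_violation x)"
  shows "f \<in> quadratic_module n \<pi>"
proof -
  obtain k where penalty: "\<And>x. x \<in> cube n radius \<Longrightarrow>
      C * (\<Sum>i<n. max 0 (- x i)) - \<eta> / 2 \<le> - (\<Sum>i<n. x i * ((1 - x i / radius) ^ k)\<^sup>2)"
    using cube_orthant_penalty[of "\<eta> / 2" C] \<open>0 < \<eta>\<close> by auto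
  define s where "s = (\<lambda>x. norm_pi_sq n \<pi> x - 1)"
  define q where "q = (\<lambda>x. norm_pi_sq n \<pi> (\<lambda>i. x i - e i))"
  define h where "h = (\<lambda>(x :: nat \<Rightarrow> real) i. ((1 - x i / radius) ^ k)\<^sup>2)"
  define H where "H = (\<lambda>x v. G x v
    + (C * off_diagonal x v + (C * (s x)\<^sup>2 - (\<Sum>i<n. x i * h x i)) * norm_pi_sq n \<pi> v))"
  have "poly_qform n H"
    unfolding H_def s_def h_def
    by (intro poly_qform_add poly_qform_mult G_form poly_qform_off_diagonal poly_qform_norm_pi_sq) auto
  show ?thesis
  proof (rule quadratic_moduleI)
    show "sos_mod n \<pi> (\<lambda>x. H x (\<lambda>i. x i - e i))"
    proof (rule poly_qform_pos_sos_mod[OF \<open>poly_qform n H\<close>])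
      fix x v assume x_mem: "x \<in> cube n radius" and v_mem: "v \<in> usphere n \<pi>"
      show "0 < H x v"
        using bound[OF x_mem v_mem] penalty[OF x_mem] \<open>0 < \<eta>\<close> v_mem
        by (simp add: H_def usphere_def constraint_violation_def s_def h_def distrib_left)
    qed auto
    have "poly_sos n q" unfolding q_def norm_pi_sq_def
      by (intro poly_sos_sum poly_sos_mult poly_sos_const poly_sos_square)
        (auto simp: less_imp_le pos)
    then show "poly_sos n (\<lambda>x. h x i * q x)" if "i < n" for i
      unfolding h_def using that by (intro poly_sos_mult poly_sos_square) auto
    show "is_poly n (\<lambda>x. \<mu> - C * s x - C * s x * q x)" unfolding s_def q_def by auto
    show "f x = H x (\<lambda>i. x i - e i) + (\<Sum>i<n. x i * (h x i * q x))
        + (\<mu> - C * s x - C * s x * q x) * (norm_pi_sq n \<pi> x - 1)" for x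
    proof -
      have "(\<Sum>i<n. x i * (h x i * q x)) = (\<Sum>i<n. x i * h x i) * q x"
        by (simp add: sum_distrib_right mult.assoc)
      then show ?thesis
        unfolding f_eq H_def off_diagonal_at_diff
        by (simp add: s_def q_def power2_eq_square algebra_simps)
    qed
  qed
qed

theorem quadratic_growth_in_quadratic_module:
  assumes "is_poly n f" "f e = 0" "0 < c"
    and growth: "\<And>x. x \<in> S_pi n \<pi> \<Longrightarrow> c * norm_pi_sq n \<pi> (\<lambda>i. x i - e i) \<le> f x"
  shows "f \<in> quadratic_module n \<pi>"
proof -
  obtain \<mu> G where G_form: "poly_qform n G"
    and f_eq: "\<And>x. f x = G x (\<lambda>i. x i - e i) + \<mu> * (norm_pi_sq n \<pi> x - 1)"
    and tangential: "\<And>v. inner_pi n \<pi> e v = 0 \<Longrightarrow> c * norm_pi_sq n \<pi> v \<le> G e v"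
    using quadratic_growth_normal_form[OF assms(1,2) _ growth] \<open>0 < c\<close> less_imp_le by metis
  have "\<exists>C. \<exists>\<eta>>0. \<forall>x\<in>cube n radius. \<forall>v\<in>usphere n \<pi>.
      \<eta> \<le> G x v + C * (off_diagonal x v + constraint_violation x)"
  proof (rule penalised_form_lower_bound[OF G_form \<open>0 < c\<close> tangential])
    show "c * norm_pi_sq n \<pi> (\<lambda>i. x i - e i) \<le> G x (\<lambda>i. x i - e i)" if "x \<in> S_pi n \<pi>" for x
      using growth[OF that] that by (simp add: f_eq S_pi_def)
  qed
  then show ?thesis using quadratic_module_if_penalised_form_pos[OF G_form f_eq] by blast
qed

end

section \<open>Markov chains and the log-Sobolev constant\<close>

lemma dirichlet_cong:
  "(\<And>i. i < n \<Longrightarrow> x i = y i) \<Longrightarrow> dirichlet n K \<pi> x = dirichlet n K \<pi> y"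
  by (simp add: dirichlet_def)

lemma dirichlet_shift: "dirichlet n K \<pi> (\<lambda>i. x i - c) = dirichlet n K \<pi> x"
  by (simp add: dirichlet_def)

lemma dirichlet_scale: "dirichlet n K \<pi> (\<lambda>i. t * x i) = t\<^sup>2 * dirichlet n K \<pi> x"
proof -
  have "(t * x i - t * x j)\<^sup>2 = t\<^sup>2 * (x i - x j)\<^sup>2" for i j
    by (simp add: power_mult_distrib flip: right_diff_distrib)
  then show ?thesis by (simp add: dirichlet_def sum_distrib_left mult_ac)
qed

lemma poly_deg_le_dirichlet: "poly_deg_le n 2 (dirichlet n K \<pi>)"
proof -
  have "poly_deg_le n (1 + 1) (\<lambda>x. (x i - x j) * (x i - x j))" if "i < n" "j < n" for i j
    using that by (intro poly_deg_le_mult poly_deg_le_diff poly_deg_le_coord)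
  then have "poly_deg_le n 2 (\<lambda>x. (x i - x j)\<^sup>2)" if "i < n" "j < n" for i j
    using that by (simp add: power2_eq_square numeral_2_eq_2)
  then show ?thesis unfolding dirichlet_def
    by (intro poly_deg_le_cmult poly_deg_le_sum) auto
qed

lemma is_poly_dirichlet: "is_poly n (dirichlet n K \<pi>)"
  unfolding is_poly_def using poly_deg_le_dirichlet by blast

lemma ent_scale_abs:
  assumes "c \<noteq> 0"
  shows "ent n \<pi> (\<lambda>i. c * \<bar>x i\<bar>) = c\<^sup>2 * ent n \<pi> x"
proof -
  have "norm_pi_sq n \<pi> (\<lambda>i. c * \<bar>x i\<bar>) = c\<^sup>2 * norm_pi_sq n \<pi> x"
    by (simp add: norm_pi_sq_def sum_distrib_left power_mult_distrib mult_ac)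
  then show ?thesis using assms unfolding ent_def sum_distrib_left
    by (intro sum.cong refl) (simp add: power_mult_distrib)
qed

lemma kpow_nonneg:
  assumes "markov_kernel n K" "i < n" "j < n"
  shows "0 \<le> kpow n K m i j"
  using assms(3)
proof (induction m arbitrary: j)
  case (Suc m)
  then show ?case using assms by (auto simp: markov_kernel_def intro!: sum_nonneg mult_nonneg_nonneg)
qed auto

lemma stationary_kpow:
  assumes "stationary n K \<pi>" "j < n"
  shows "(\<Sum>i<n. \<pi> i * kpow n K m i j) = \<pi> j"
  using assms(2)
proof (induction m arbitrary: j)
  case 0
  have "(\<Sum>i<n. \<pi> i * kpow n K 0 i j) = (\<Sum>i<n. if i = j then \<pi> i else 0)"
    by (intro sum.cong) auto
  then show ?case using 0 by simp
next
  case (Suc m)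
  have "(\<Sum>i<n. \<pi> i * kpow n K (Suc m) i j) = (\<Sum>l<n. (\<Sum>i<n. \<pi> i * kpow n K m i l) * K l j)"
    unfolding kpow.simps sum_distrib_left sum_distrib_right by (subst sum.swap) (simp add: mult.assoc)
  also have "\<dots> = (\<Sum>l<n. \<pi> l * K l j)" using Suc.IH by (intro sum.cong) auto
  also have "\<dots> = \<pi> j" using assms(1) Suc.prems by (simp add: stationary_def)
  finally show ?case .
qed

locale irreducible_chain =
  fixes n :: nat and K :: "nat \<Rightarrow> nat \<Rightarrow> real" and \<pi> :: "nat \<Rightarrow> real"
  assumes kernel: "markov_kernel n K" and irreducible: "irreducible_kernel n K"
    and stationary: "stationary n K \<pi>"
begin

abbreviation energy :: "(nat \<Rightarrow> real) \<Rightarrow> real" where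
  "energy \<equiv> dirichlet n K \<pi>"

lemma total_mass: "(\<Sum>i<n. \<pi> i) = 1"
  using stationary by (simp add: stationary_def)

lemma stationary_pos:
  assumes j_less: "j < n"
  shows "0 < \<pi> j"
proof -
  have nonneg: "\<And>i. i < n \<Longrightarrow> 0 \<le> \<pi> i" using stationary by (simp add: stationary_def)
  have "\<exists>i\<in>{..<n}. \<pi> i \<noteq> 0"
    using total_mass sum.not_neutral_contains_not_neutral[of \<pi> "{..<n}"] by force
  then obtain i where i_charged: "i < n" "0 < \<pi> i" using nonneg by force
  obtain m where path_pos: "0 < kpow n K m i j"
    using irreducible i_charged j_less by (auto simp: irreducible_kernel_def)
  have "0 < \<pi> i * kpow n K m i j" using i_charged path_pos by simp
  also have "\<dots> \<le> (\<Sum>i<n. \<pi> i * kpow n K m i j)"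
    using i_charged j_less nonneg kpow_nonneg[OF kernel] by (intro member_le_sum) auto
  also have "\<dots> = \<pi> j" by (rule stationary_kpow[OF stationary j_less])
  finally show ?thesis .
qed

sublocale interior_sphere_point n \<pi> "\<lambda>_. 1"
  by unfold_locales (auto simp: stationary_pos norm_pi_sq_def total_mass)

lemma energy_term_nonneg: "i < n \<Longrightarrow> j < n \<Longrightarrow> 0 \<le> \<pi> i * K i j * r\<^sup>2"
  using kernel stationary_pos[of i] by (simp add: markov_kernel_def)

lemma energy_nonneg: "0 \<le> energy x"
  unfolding dirichlet_def by (auto intro!: sum_nonneg energy_term_nonneg)

lemma energy_abs_le: "energy (\<lambda>i. \<bar>x i\<bar>) \<le> energy x"
proof -
  have "(\<bar>a\<bar> - \<bar>b\<bar>)\<^sup>2 \<le> (a - b)\<^sup>2" for a b :: real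
    by (rule abs_le_square_iff[THEN iffD1]) auto
  then show ?thesis using kernel stationary_pos unfolding dirichlet_def markov_kernel_def
    by (auto intro!: mult_left_mono sum_mono simp: less_imp_le)
qed

lemma energy_eq_0_imp_eq_neighbours:
  assumes "energy x = 0" "i < n" "j < n" "K i j \<noteq> 0"
  shows "x i = x j"
proof -
  have "(\<Sum>i<n. \<Sum>j<n. \<pi> i * K i j * (x i - x j)\<^sup>2) = 0"
    using assms(1) by (simp add: dirichlet_def)
  then have "(\<Sum>j<n. \<pi> i * K i j * (x i - x j)\<^sup>2) = 0"
    by (rule sum_nonneg_0[of "{..<n}", rotated 2])
      (use assms in \<open>auto intro!: sum_nonneg energy_term_nonneg\<close>)
  then have "\<pi> i * K i j * (x i - x j)\<^sup>2 = 0"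
    by (rule sum_nonneg_0[of "{..<n}", rotated 2]) (use assms in \<open>auto intro!: energy_term_nonneg\<close>)
  then show ?thesis using assms stationary_pos[of i] by simp
qed

lemma energy_eq_0_imp_constant:
  assumes "energy x = 0" "i < n" "j < n"
  shows "x i = x j"
proof -
  have "kpow n K m i j \<noteq> 0 \<Longrightarrow> x i = x j" if "j < n" for m j
    using that
  proof (induction m arbitrary: j)
    case (Suc m)
    then obtain l where "l < n" "kpow n K m i l * K l j \<noteq> 0"
      by (metis (mono_tags, lifting) kpow.simps(2) lessThan_iff sum.neutral)
    then show ?case
      using Suc.IH[of l] energy_eq_0_imp_eq_neighbours[OF assms(1), of l j] Suc.prems by auto
  qed (auto split: if_splits)
  then show ?thesis using irreducible assms by (metis irreducible_kernel_def less_irrefl)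
qed

lemma energy_pos:
  assumes mean: "inner_pi n \<pi> (\<lambda>_. 1) v = 0" and nonzero: "\<exists>i<n. v i \<noteq> 0"
  shows "0 < energy v"
proof (rule ccontr)
  assume "\<not> 0 < energy v"
  then have "energy v = 0" using energy_nonneg[of v] by linarith
  obtain i where i_nonzero: "i < n" "v i \<noteq> 0" using nonzero by blast
  have "\<pi> j * (1 * v j) = \<pi> j * v i" if "j < n" for j
    using energy_eq_0_imp_constant[OF \<open>energy v = 0\<close> that i_nonzero(1)] by simp
  then have "inner_pi n \<pi> (\<lambda>_. 1) v = (\<Sum>j<n. \<pi> j) * v i"
    unfolding inner_pi_def sum_distrib_right by (intro sum.cong) auto
  then show False using i_nonzero(2) mean total_mass by simp
qed

lemma Poincare_inequality:
  obtains c where "0 < c"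
    and "\<And>v. inner_pi n \<pi> (\<lambda>_. 1) v = 0 \<Longrightarrow> c * norm_pi_sq n \<pi> v \<le> energy v"
proof -
  let ?F = "\<lambda>C v. energy v + C * (inner_pi n \<pi> (\<lambda>_. 1) v)\<^sup>2"
  obtain C c where "0 \<le> C" and c_pos: "0 < c" and bound: "\<And>v. v \<in> usphere n \<pi> \<Longrightarrow> c \<le> ?F C v"
  proof (rule compact_penalty[OF compact_usphere, of energy])
    show "continuous_on (usphere n \<pi>) energy"
      by (rule continuous_on_is_poly[OF is_poly_dirichlet continuous_on_id])
    show "continuous_on (usphere n \<pi>) (\<lambda>v. (inner_pi n \<pi> (\<lambda>_. 1) v)\<^sup>2)"
      by (rule continuous_on_is_poly[OF _ continuous_on_id]) (auto simp: inner_pi_def)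
    show "0 < energy v" if "v \<in> usphere n \<pi>" "(inner_pi n \<pi> (\<lambda>_. 1) v)\<^sup>2 = 0" for v
      using energy_pos usphere_nonzero that by simp
  qed (auto intro: that)
  have "c * norm_pi_sq n \<pi> v \<le> ?F C v" for v
  proof (rule homogeneous_lower_bound[OF _ _ bound])
    show "?F C (\<lambda>i. t * v i) = t\<^sup>2 * ?F C v" for t v
      using inner_pi_combination[of n \<pi> "\<lambda>_. 1" t v 0 v]
      by (simp add: dirichlet_scale power_mult_distrib algebra_simps)
    show "?F C v = ?F C w" if "\<And>i. i < n \<Longrightarrow> v i = w i" for v w
      using that by (simp add: inner_pi_def cong: dirichlet_cong)
  qed
  with c_pos that[of c] show ?thesis by (metis add.right_neutral mult_zero_right zero_power2)
qed

text \<open>For \<open>x\<close> in \<open>S\<^sup>\<pi>\<close> with mean \<open>m \<ge> 0\<close> the variance is \<open>1 - m\<^sup>2 \<ge> 1 - m = \<parallel>x - 1\<parallel>\<^sup>2 / 2\<close>.\<close>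
lemma energy_quadratic_growth:
  obtains c where "0 < c"
    and "\<And>x. x \<in> S_pi n \<pi> \<Longrightarrow> c * norm_pi_sq n \<pi> (\<lambda>i. x i - 1) \<le> energy x"
proof -
  obtain c where c_pos: "0 < c"
    and Poincare: "\<And>v. inner_pi n \<pi> (\<lambda>_. 1) v = 0 \<Longrightarrow> c * norm_pi_sq n \<pi> v \<le> energy v"
    using Poincare_inequality by blast
  have "c / 2 * norm_pi_sq n \<pi> (\<lambda>i. x i - 1) \<le> energy x" if x_mem: "x \<in> S_pi n \<pi>" for x
  proof -
    define m where "m = inner_pi n \<pi> (\<lambda>_. 1) x"
    have norm_x: "norm_pi_sq n \<pi> x = 1" using x_mem by (simp add: S_pi_def)
    have m_nonneg: "0 \<le> m"
      using x_mem pos unfolding m_def inner_pi_def S_pi_def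
      by (auto intro!: sum_nonneg simp: less_imp_le)
    have variance: "norm_pi_sq n \<pi> (\<lambda>i. x i - m) = 1 - m\<^sup>2"
      using norm_pi_sq_combination[of n \<pi> 1 x "- m" "\<lambda>_. 1"]
      by (simp add: norm_e norm_x inner_pi_commute[of n \<pi> x] m_def[symmetric] power2_eq_square)
    have distance: "norm_pi_sq n \<pi> (\<lambda>i. x i - 1) = 2 * (1 - m)"
      using norm_pi_sq_combination[of n \<pi> 1 x "- 1" "\<lambda>_. 1"]
      by (simp add: norm_e norm_x inner_pi_commute[of n \<pi> x] m_def[symmetric])
    have "m * m \<le> m"
      using norm_nonneg[of "\<lambda>i. x i - m"] m_nonneg power2_le_imp_le[of m 1]
      by (simp add: variance mult_left_le)
    then have "c / 2 * (2 * (1 - m)) \<le> c * (1 - m\<^sup>2)"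
      using c_pos by (simp add: power2_eq_square)
    also have "\<dots> = c * norm_pi_sq n \<pi> (\<lambda>i. x i - m)" by (simp add: variance)
    also have "\<dots> \<le> energy (\<lambda>i. x i - m)"
      using inner_pi_combination[of n \<pi> "\<lambda>_. 1" 1 x "- m" "\<lambda>_. 1"]
      by (intro Poincare) (simp add: m_def inner_pi_self norm_e)
    also have "\<dots> = energy x" by (rule dirichlet_shift)
    finally show ?thesis by (simp add: distance)
  qed
  with c_pos that[of "c / 2"] show ?thesis by simp
qed

lemma ent_le_energy:
  assumes "0 \<le> g" and on_sphere: "\<And>x. x \<in> S_pi n \<pi> \<Longrightarrow> ent n \<pi> x \<le> g * energy x"
  shows "ent n \<pi> x \<le> g * energy x"
proof (cases "norm_pi_sq n \<pi> x = 0")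
  case True
  then have "ent n \<pi> x = 0" unfolding norm_eq_0_iff ent_def by (intro sum.neutral) auto
  then show ?thesis using \<open>0 \<le> g\<close> energy_nonneg by simp
next
  case False
  define r where "r = sqrt (norm_pi_sq n \<pi> x)"
  have r_norm: "0 < r" "r\<^sup>2 = norm_pi_sq n \<pi> x" using False norm_nonneg[of x] by (auto simp: r_def)
  define z where "z = (\<lambda>i. (1 / r) * \<bar>x i\<bar>)"
  have "norm_pi_sq n \<pi> (\<lambda>i. \<bar>x i\<bar>) = r\<^sup>2" unfolding r_norm(2) by (simp add: norm_pi_sq_def)
  then have "norm_pi_sq n \<pi> z = 1"
    unfolding z_def norm_pi_sq_scale using r_norm(1) by (simp add: power_divide)
  then have z_mem: "z \<in> S_pi n \<pi>" using r_norm by (auto simp: S_pi_def z_def)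
  have "(1 / r)\<^sup>2 * ent n \<pi> x = ent n \<pi> z"
    unfolding z_def using r_norm(1) by (intro ent_scale_abs[symmetric]) auto
  also have "\<dots> \<le> g * energy z" by (rule on_sphere[OF z_mem])
  also have "energy z = (1 / r)\<^sup>2 * energy (\<lambda>i. \<bar>x i\<bar>)" unfolding z_def by (rule dirichlet_scale)
  also have "g * \<dots> \<le> g * ((1 / r)\<^sup>2 * energy x)"
    using \<open>0 \<le> g\<close> energy_abs_le by (intro mult_left_mono) auto
  finally have "(1 / r)\<^sup>2 * ent n \<pi> x \<le> (1 / r)\<^sup>2 * (g * energy x)" by (simp add: mult_ac)
  then show ?thesis by (rule mult_left_le_imp_le) (use r_norm(1) in auto)
qed

lemma ent_positive_point:
  assumes "2 \<le> n"
  obtains x where "x \<in> S_pi n \<pi>" "0 < ent n \<pi> x"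
proof -
  define x where "x = (\<lambda>i::nat. if i = 0 then 1 / sqrt (\<pi> 0) else (0::real))"
  have weights: "0 < \<pi> 0" "0 < \<pi> 1" using assms pos by auto
  have "(\<Sum>i\<in>{0,1}. \<pi> i) \<le> (\<Sum>i<n. \<pi> i)"
    using assms pos by (intro sum_mono2) (auto intro: less_imp_le)
  then have "\<pi> 0 < 1" using weights total_mass by simp
  have x_0_sq: "(x 0)\<^sup>2 = 1 / \<pi> 0" using weights by (simp add: x_def power_divide)
  have "norm_pi_sq n \<pi> x = (\<Sum>i<n. if i = 0 then 1 else 0)"
    unfolding norm_pi_sq_def using x_0_sq weights by (intro sum.cong refl) (auto simp: x_def)
  then have norm_x: "norm_pi_sq n \<pi> x = 1" using assms by simp
  have "ent n \<pi> x = (\<Sum>i<n. if i = 0 then ln (1 / \<pi> 0) else 0)"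
    unfolding ent_def norm_x using x_0_sq weights by (intro sum.cong refl) (auto simp: x_def)
  also have "\<dots> = ln (1 / \<pi> 0)" using assms by simp
  also have "\<dots> > 0" using weights \<open>\<pi> 0 < 1\<close> by simp
  finally have "0 < ent n \<pi> x" .
  moreover have "x \<in> S_pi n \<pi>" using norm_x weights by (auto simp: S_pi_def x_def)
  ultimately show ?thesis using that by blast
qed

lemma ent_one: "ent n \<pi> (\<lambda>_. 1) = 0"
  by (simp add: ent_def norm_e)

lemma one_in_S_pi: "(\<lambda>_. 1) \<in> S_pi n \<pi>"
  by (simp add: S_pi_def norm_e)

end

text \<open>For \<open>n = 1\<close> the entropy vanishes identically, so \<^const>\<open>log_sobolev\<close> would be the supremum of an
  unbounded set.\<close>
locale nontrivial_irreducible_chain = irreducible_chain +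
  assumes n_ge_2: "2 \<le> n"
begin

abbreviation \<alpha> :: real where
  "\<alpha> \<equiv> log_sobolev n K \<pi>"

lemma bdd_above_log_sobolev: "bdd_above {a. \<forall>x. a * ent n \<pi> x \<le> energy x}"
proof -
  obtain x where ent_pos: "0 < ent n \<pi> x" using ent_positive_point[OF n_ge_2] by blast
  show ?thesis
  proof (rule bdd_aboveI)
    fix a assume "a \<in> {a. \<forall>x. a * ent n \<pi> x \<le> energy x}"
    then show "a \<le> energy x / ent n \<pi> x" using ent_pos by (simp add: pos_le_divide_eq)
  qed
qed

lemma le_log_sobolev: "(\<And>x. a * ent n \<pi> x \<le> energy x) \<Longrightarrow> a \<le> \<alpha>"
  unfolding log_sobolev_def by (intro cSup_upper bdd_above_log_sobolev) auto

lemma log_sobolev_nonneg: "0 \<le> \<alpha>"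
  by (rule le_log_sobolev) (simp add: energy_nonneg)

lemma log_sobolev_inequality: "\<alpha> * ent n \<pi> x \<le> energy x"
proof (cases "0 < ent n \<pi> x")
  case True
  have "\<alpha> \<le> energy x / ent n \<pi> x"
    unfolding log_sobolev_def
  proof (rule cSup_least)
    show "{a. \<forall>x. a * ent n \<pi> x \<le> energy x} \<noteq> {}"
      using energy_nonneg by (auto intro!: exI[of _ 0])
  qed (use True in \<open>simp add: pos_le_divide_eq\<close>)
  then show ?thesis using True by (simp add: pos_le_divide_eq)
next
  case False
  then have "\<alpha> * ent n \<pi> x \<le> 0" using log_sobolev_nonneg by (simp add: mult_nonneg_nonpos)
  then show ?thesis using energy_nonneg[of x] by linarith
qed

lemma gamma_set_bounded_below:
  assumes gamma_mem: "\<gamma> \<in> gamma_set n K \<pi> P d"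
    and ent_le: "\<And>x. x \<in> S_pi n \<pi> \<Longrightarrow> ent n \<pi> x \<le> P x"
  shows "0 < \<alpha>" "1 / \<alpha> \<le> \<gamma>"
proof -
  have on_sphere: "ent n \<pi> x \<le> \<gamma> * energy x" if x_mem: "x \<in> S_pi n \<pi>" for x
    using SOS_S_nonneg[OF gamma_mem[unfolded gamma_set_def mem_Collect_eq] x_mem] ent_le[OF x_mem]
    by simp
  obtain x where witness: "x \<in> S_pi n \<pi>" "0 < ent n \<pi> x" using ent_positive_point[OF n_ge_2] .
  have "0 < \<gamma> * energy x" using on_sphere[OF witness(1)] witness(2) by linarith
  then have gamma_pos: "0 < \<gamma>" using energy_nonneg[of x] by (auto simp: zero_less_mult_iff)
  have "1 / \<gamma> * ent n \<pi> x \<le> energy x" for x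
    using ent_le_energy[of \<gamma> x] on_sphere gamma_pos by (simp add: field_simps)
  then have "1 / \<gamma> \<le> \<alpha>" by (rule le_log_sobolev)
  moreover have "0 < 1 / \<gamma>" using gamma_pos by simp
  ultimately show "0 < \<alpha>" by linarith
  then show "1 / \<alpha> \<le> \<gamma>" using \<open>1 / \<gamma> \<le> \<alpha>\<close> gamma_pos by (simp add: field_simps)
qed

lemma inverse_le_Inf_gamma_set:
  assumes "gamma_set n K \<pi> P d \<noteq> {}" "\<And>x. x \<in> S_pi n \<pi> \<Longrightarrow> ent n \<pi> x \<le> P x"
  shows "0 < \<alpha>" "1 / \<alpha> \<le> Inf (gamma_set n K \<pi> P d)"
  using assms gamma_set_bounded_below by (blast, blast intro: cInf_greatest)

lemma alpha_P_le_log_sobolev: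
  assumes "\<And>x. x \<in> S_pi n \<pi> \<Longrightarrow> ent n \<pi> x \<le> P x"
  shows "alpha_P n K \<pi> P d \<le> \<alpha>"
proof (cases "gamma_set n K \<pi> P d = {}")
  case True
  then show ?thesis using log_sobolev_nonneg by (simp add: alpha_P_def)
next
  case False
  note bound = inverse_le_Inf_gamma_set[OF False assms]
  then have "1 / Inf (gamma_set n K \<pi> P d) \<le> 1 / (1 / \<alpha>)" by (intro frac_le) auto
  then show ?thesis using False by (simp add: alpha_P_def)
qed

lemma alpha_P_nonneg:
  assumes "\<And>x. x \<in> S_pi n \<pi> \<Longrightarrow> ent n \<pi> x \<le> P x"
  shows "0 \<le> alpha_P n K \<pi> P d"
proof (cases "gamma_set n K \<pi> P d = {}")
  case False
  have "0 \<le> 1 / \<alpha>" using log_sobolev_nonneg by simp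
  also note inverse_le_Inf_gamma_set(2)[OF False assms]
  finally show ?thesis by (simp add: alpha_P_def)
qed (simp add: alpha_P_def)

lemma inverse_le_alpha_P:
  assumes gamma_mem: "\<gamma> \<in> gamma_set n K \<pi> P d" and ent_le: "\<And>x. x \<in> S_pi n \<pi> \<Longrightarrow> ent n \<pi> x \<le> P x"
  shows "1 / \<gamma> \<le> alpha_P n K \<pi> P d"
proof -
  have nonempty: "gamma_set n K \<pi> P d \<noteq> {}" using gamma_mem by blast
  note bound = inverse_le_Inf_gamma_set[OF nonempty ent_le]
  have "Inf (gamma_set n K \<pi> P d) \<le> \<gamma>"
    using gamma_mem gamma_set_bounded_below(2)[OF _ ent_le] by (intro cInf_lower bdd_belowI)
  moreover have "0 < Inf (gamma_set n K \<pi> P d)"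
    using bound by (smt (verit) zero_less_divide_1_iff)
  ultimately have "1 / \<gamma> \<le> 1 / Inf (gamma_set n K \<pi> P d)" by (intro frac_le) auto
  then show ?thesis using nonempty by (simp add: alpha_P_def)
qed

lemma energy_gap_in_quadratic_module:
  assumes "is_poly n P" "0 < \<alpha>" "b / \<alpha> < \<gamma>" "0 \<le> b"
    and P_one: "P (\<lambda>_. 1) = 0" and P_le: "\<And>x. x \<in> S_pi n \<pi> \<Longrightarrow> P x \<le> b * ent n \<pi> x"
  shows "(\<lambda>x. \<gamma> * energy x - P x) \<in> quadratic_module n \<pi>"
proof -
  define \<delta> where "\<delta> = \<gamma> - b / \<alpha>"
  have "0 < \<delta>" using assms(3) by (simp add: \<delta>_def)
  have energy_le: "\<delta> * energy x \<le> \<gamma> * energy x - P x" if "x \<in> S_pi n \<pi>" for x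
  proof -
    have "b * ent n \<pi> x \<le> b * (energy x / \<alpha>)"
      using log_sobolev_inequality[of x] \<open>0 < \<alpha>\<close> \<open>0 \<le> b\<close>
      by (intro mult_left_mono) (auto simp: field_simps)
    then show ?thesis using P_le[OF that] by (simp add: \<delta>_def left_diff_distrib)
  qed
  obtain c where "0 < c"
    and growth: "\<And>x. x \<in> S_pi n \<pi> \<Longrightarrow> c * norm_pi_sq n \<pi> (\<lambda>i. x i - 1) \<le> energy x"
    using energy_quadratic_growth by blast
  show ?thesis
  proof (rule quadratic_growth_in_quadratic_module)
    show "is_poly n (\<lambda>x. \<gamma> * energy x - P x)" using \<open>is_poly n P\<close> is_poly_dirichlet by auto
    show "\<gamma> * energy (\<lambda>_. 1) - P (\<lambda>_. 1) = 0" by (simp add: P_one dirichlet_def)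
    show "0 < \<delta> * c" using \<open>0 < \<delta>\<close> \<open>0 < c\<close> by simp
    show "\<delta> * c * norm_pi_sq n \<pi> (\<lambda>i. x i - 1) \<le> \<gamma> * energy x - P x" if x_mem: "x \<in> S_pi n \<pi>" for x
    proof -
      have "\<delta> * (c * norm_pi_sq n \<pi> (\<lambda>i. x i - 1)) \<le> \<delta> * energy x"
        using growth[OF x_mem] \<open>0 < \<delta>\<close> by simp
      also note energy_le[OF x_mem]
      finally show ?thesis by (simp add: mult.assoc)
    qed
  qed
qed

theorem eventually_in_gamma_set:
  assumes P_poly: "is_poly n P" and "0 < \<alpha>" "b / \<alpha> < \<gamma>" "0 \<le> b"
    and "P (\<lambda>_. 1) = 0" and "\<And>x. x \<in> S_pi n \<pi> \<Longrightarrow> P x \<le> b * ent n \<pi> x"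
  shows "\<forall>\<^sub>F d in sequentially. poly_degree n P \<le> 2 * d \<longrightarrow> \<gamma> \<in> gamma_set n K \<pi> P d"
proof -
  have "(\<lambda>x. \<gamma> * energy x - P x) \<in> quadratic_module n \<pi>"
    using assms by (rule energy_gap_in_quadratic_module)
  from quadratic_module_eventually_SOS_S[OF this] eventually_ge_at_top[of 1] show ?thesis
  proof eventually_elim
    case (elim d)
    have "poly_deg_le n (2 * d) (\<lambda>x. \<gamma> * energy x - P x)" if "poly_degree n P \<le> 2 * d"
      using elim poly_deg_le_degree[OF P_poly that] poly_deg_le_mono[OF poly_deg_le_dirichlet]
      by (intro poly_deg_le_diff poly_deg_le_cmult) auto
    then show ?case using elim by (simp add: gamma_set_def)
  qed
qed

end

theorem mainTheorem2:
  fixes n :: nat and K :: "nat \<Rightarrow> nat \<Rightarrow> real" and \<pi> :: "nat \<Rightarrow> real"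
    and \<epsilon> :: real and P :: "(nat \<Rightarrow> real) \<Rightarrow> real"
  assumes "2 \<le> n"
    and "markov_kernel n K" and "irreducible_kernel n K" and "stationary n K \<pi>"
    and "0 < \<epsilon>" and "\<epsilon> < 1"
    and "is_poly n P"
    and "\<forall>x\<in>S_pi n \<pi>. ent n \<pi> x \<le> P x \<and> P x \<le> (1 + \<epsilon>) * ent n \<pi> x"
  shows "(\<forall>d. poly_degree n P \<le> 2 * d \<longrightarrow> alpha_P n K \<pi> P d \<le> log_sobolev n K \<pi>)
       \<and> (\<exists>d0. \<forall>d\<ge>d0. poly_degree n P \<le> 2 * d \<longrightarrow>
              (1 - \<epsilon>) * log_sobolev n K \<pi> \<le> alpha_P n K \<pi> P d)"
proof -
  interpret nontrivial_irreducible_chain n K \<pi>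
    using assms(1-4) by unfold_locales
  have ent_le: "ent n \<pi> x \<le> P x" and P_le: "P x \<le> (1 + \<epsilon>) * ent n \<pi> x" if "x \<in> S_pi n \<pi>" for x
    using assms(8) that by auto
  have "\<exists>d0. \<forall>d\<ge>d0. poly_degree n P \<le> 2 * d \<longrightarrow> (1 - \<epsilon>) * \<alpha> \<le> alpha_P n K \<pi> P d"
  proof (cases "\<alpha> = 0")
    case True
    then show ?thesis using alpha_P_nonneg[OF ent_le] by simp
  next
    case False
    then have "0 < \<alpha>" using log_sobolev_nonneg by simp
    have "1 + \<epsilon> < 1 / (1 - \<epsilon>)" using assms(5,6) by (simp add: field_simps)
    from divide_strict_right_mono[OF this \<open>0 < \<alpha>\<close>]
    have "(1 + \<epsilon>) / \<alpha> < 1 / ((1 - \<epsilon>) * \<alpha>)" by simp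
    moreover have "P (\<lambda>_. 1) = 0"
      using ent_le[OF one_in_S_pi] P_le[OF one_in_S_pi] by (simp add: ent_one)
    ultimately have "\<forall>\<^sub>F d in sequentially. poly_degree n P \<le> 2 * d \<longrightarrow>
        1 / ((1 - \<epsilon>) * \<alpha>) \<in> gamma_set n K \<pi> P d"
      using assms(5,7) \<open>0 < \<alpha>\<close> P_le by (intro eventually_in_gamma_set[where b = "1 + \<epsilon>"]) auto
    then show ?thesis
      using inverse_le_alpha_P[OF _ ent_le] by (fastforce simp: eventually_sequentially)
  qed
  with alpha_P_le_log_sobolev[OF ent_le] show ?thesis by blast
qed

end
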